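(* Let $n>1$ and let $M^{2n+1}(\varphi,\xi,\eta,g)$ be a Kenmotsu manifold. Suppose that $g$ represents an almost $*$-Ricci soliton with potential vector field $V$ and soliton function $\lambda\in C^\infty(M)$, i.e. $\frac12\pounds_V g+\mathrm{Ric}^*=\lambda g$, and that $V$ is Jacobi along $\xi$, i.e. $\nabla_\xi\nabla_\xi V+R(V,\xi)\xi=0$. Then it is a steady $*$-Ricci soliton, i.e. $\lambda=0$ identically on $M$.
   Context: An almost contact metric manifold $M^{2n+1}(\varphi,\xi,\eta,g)$ is a smooth $(2n+1)$-dimensional manifold with a $(1,1)$-tensor field $\varphi$, a vector field $\xi$ (the Reeb vector field), a $1$-form $\eta$ and a Riemannian metric $g$ satisfying $\varphi^2=-\mathrm{id}+\eta\otimes\xi$, $\eta(\xi)=1$ and $g(\varphi X,\varphi Y)=g(X,Y)-\eta(X)\eta(Y)$ for all vector fields $X,Y$. It is a Kenmotsu manifold if $(\nabla_X\varphi)Y=g(\varphi X,Y)\xi-\eta(Y)\varphi X$ for all vector fields $X,Y$, where $\nabla$ is the Levi-Civita connection of $g$. Curvature convention: $R(X,Y)Z=\nabla_X\nabla_YZ-\nabla_Y\nabla_XZ-\nabla_{[X,Y]}Z$ (so that on a Kenmotsu manifold $R(X,Y)\xi=\eta(X)Y-\eta(Y)X$). $\pounds_V$ denotes the Lie derivative along $V$. The $*$-Ricci tensor is $\mathrm{Ric}^*(X,Y)=\frac12\mathrm{Tr}\{\varphi\circ R(X,\varphi Y)\}=-\frac12\sum_i g(R(X,\varphi Y)e_i,\varphi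 e_i)$ for a local orthonormal frame $\{e_i\}$. The metric $g$ represents an almost $*$-Ricci soliton with potential vector field $V$ if there is a smooth function $\lambda$ on $M$ with $\frac12\pounds_Vg+\mathrm{Ric}^*=\lambda g$; it is a $*$-Ricci soliton if $\lambda$ is constant, and it is called steady if $\lambda$ is zero. *)

theory Defs
  imports "HOL-Analysis.Analysis"
begin

section \<open>Smooth maps\<close>

primrec Ck_on ::
  "nat \<Rightarrow> 'e::real_normed_vector set \<Rightarrow> ('e \<Rightarrow> 'f::real_normed_vector) \<Rightarrow> bool" where
  "Ck_on 0 S f \<longleftrightarrow> continuous_on S f"
| "Ck_on (Suc k) S f \<longleftrightarrow>
     (\<forall>x\<in>S. f differentiable (at x)) \<and>
     (\<forall>u. Ck_on k S (\<lambda>x. frechet_derivative f (at x) u))"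

text \<open>Only used for open subsets of finite-dimensional spaces, where smoothness of all
  directional derivatives is the usual notion.\<close>

definition smooth_on ::
  "'e::real_normed_vector set \<Rightarrow> ('e \<Rightarrow> 'f::real_normed_vector) \<Rightarrow> bool" where
  "smooth_on S f \<longleftrightarrow> (\<forall>k. Ck_on k S f)"


section \<open>Smooth manifolds\<close>

type_synonym ('a, 'm) chart = "'a set \<times> ('a \<Rightarrow> real ^ 'm)"

definition chart_image :: "('a, 'm) chart \<Rightarrow> (real ^ 'm) set" where
  "chart_image c = snd c ` fst c"

definition chart_inv :: "('a, 'm) chart \<Rightarrow> real ^ 'm \<Rightarrow> 'a" where
  "chart_inv c = inv_into (fst c) (snd c)"

definition overlap :: "('a, 'm) chart \<Rightarrow> ('a, 'm) chart \<Rightarrow> (real ^ 'm) set" where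
  "overlap c c' = snd c ` (fst c \<inter> fst c')"

definition transition :: "('a, 'm) chart \<Rightarrow> ('a, 'm) chart \<Rightarrow> real ^ 'm \<Rightarrow> real ^ 'm" where
  "transition c c' = snd c' \<circ> chart_inv c"

definition smooth_manifold :: "'a topology \<Rightarrow> ('a, 'm::finite) chart set \<Rightarrow> bool" where
  "smooth_manifold M A \<longleftrightarrow>
     Hausdorff_space M \<and> second_countable M \<and>
     (\<forall>c\<in>A. openin M (fst c) \<and> open (chart_image c) \<and>
        homeomorphic_map (subtopology M (fst c)) (top_of_set (chart_image c)) (snd c)) \<and>
     (\<Union>c\<in>A. fst c) = topspace M \<and>
     (\<forall>c\<in>A. \<forall>c'\<in>A. smooth_on (overlap c c') (transition c c'))"


section \<open>Tensor fields\<close>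

text \<open>A tensor field is given by its local representatives in the charts of the atlas, subject to
  the usual transformation law under changes of coordinates: the tangent vector with
  components \<open>u\<close> at \<open>x\<close> in the chart \<open>c\<close> has components
  \<open>tangent_transition c c' x u\<close> in the chart \<open>c'\<close>. The values of a representative outside
  \<open>chart_image c\<close> are irrelevant.\<close>

definition tangent_transition ::
  "('a, 'm::finite) chart \<Rightarrow> ('a, 'm) chart \<Rightarrow> real ^ 'm \<Rightarrow> real ^ 'm \<Rightarrow> real ^ 'm" where
  "tangent_transition c c' x = frechet_derivative (transition c c') (at x)"

type_synonym ('a, 'm) vfield = "('a, 'm) chart \<Rightarrow> real ^ 'm \<Rightarrow> real ^ 'm"
type_synonym ('a, 'm) form1 = "('a, 'm) chart \<Rightarrow> real ^ 'm \<Rightarrow> real ^ 'm \<Rightarrow> real"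
type_synonym ('a, 'm) endo = "('a, 'm) chart \<Rightarrow> real ^ 'm \<Rightarrow> real ^ 'm \<Rightarrow> real ^ 'm"
type_synonym ('a, 'm) form2 = "('a, 'm) chart \<Rightarrow> real ^ 'm \<Rightarrow> real ^ 'm \<Rightarrow> real ^ 'm \<Rightarrow> real"
type_synonym ('a, 'm) conn = "('a, 'm) chart \<Rightarrow> real ^ 'm \<Rightarrow> real ^ 'm \<Rightarrow> real ^ 'm \<Rightarrow> real ^ 'm"

definition smooth_function :: "('a, 'm::finite) chart set \<Rightarrow> ('a \<Rightarrow> real) \<Rightarrow> bool" where
  "smooth_function A f \<longleftrightarrow> (\<forall>c\<in>A. smooth_on (chart_image c) (f \<circ> chart_inv c))"

definition vector_field :: "('a, 'm::finite) chart set \<Rightarrow> ('a, 'm) vfield \<Rightarrow> bool" where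
  "vector_field A X \<longleftrightarrow>
     (\<forall>c\<in>A. smooth_on (chart_image c) (X c)) \<and>
     (\<forall>c\<in>A. \<forall>c'\<in>A. \<forall>x\<in>overlap c c'.
        X c' (transition c c' x) = tangent_transition c c' x (X c x))"

definition one_form :: "('a, 'm::finite) chart set \<Rightarrow> ('a, 'm) form1 \<Rightarrow> bool" where
  "one_form A \<eta> \<longleftrightarrow>
     (\<forall>c\<in>A. (\<forall>x\<in>chart_image c. linear (\<eta> c x)) \<and>
        (\<forall>u. smooth_on (chart_image c) (\<lambda>x. \<eta> c x u))) \<and>
     (\<forall>c\<in>A. \<forall>c'\<in>A. \<forall>x\<in>overlap c c'. \<forall>u.
        \<eta> c' (transition c c' x) (tangent_transition c c' x u) = \<eta> c x u)"

definition endo_field :: "('a, 'm::finite) chart set \<Rightarrow> ('a, 'm) endo \<Rightarrow> bool" where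
  "endo_field A \<phi> \<longleftrightarrow>
     (\<forall>c\<in>A. (\<forall>x\<in>chart_image c. linear (\<phi> c x)) \<and>
        (\<forall>u. smooth_on (chart_image c) (\<lambda>x. \<phi> c x u))) \<and>
     (\<forall>c\<in>A. \<forall>c'\<in>A. \<forall>x\<in>overlap c c'. \<forall>u.
        \<phi> c' (transition c c' x) (tangent_transition c c' x u) =
          tangent_transition c c' x (\<phi> c x u))"

definition riemannian_metric :: "('a, 'm::finite) chart set \<Rightarrow> ('a, 'm) form2 \<Rightarrow> bool" where
  "riemannian_metric A g \<longleftrightarrow>
     (\<forall>c\<in>A.
        (\<forall>x\<in>chart_image c. bilinear (g c x) \<and> (\<forall>u v. g c x u v = g c x v u) \<and>
           (\<forall>u. u \<noteq> 0 \<longrightarrow> 0 < g c x u u)) \<and>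
        (\<forall>u v. smooth_on (chart_image c) (\<lambda>x. g c x u v))) \<and>
     (\<forall>c\<in>A. \<forall>c'\<in>A. \<forall>x\<in>overlap c c'. \<forall>u v.
        g c' (transition c c' x) (tangent_transition c c' x u) (tangent_transition c c' x v) =
          g c x u v)"


section \<open>Connections, curvature and Lie derivative\<close>

text \<open>The operators below act on vector fields on a coordinate domain, i.e. on maps
  \<open>real ^ 'm \<Rightarrow> real ^ 'm\<close>. Here \<open>G\<close> is the Christoffel symbol of a connection in that domain,
  so that \<open>covd G X Y\<close> is \<open>\<nabla>\<^sub>X Y\<close> with components \<open>X(Y\<^sup>k) + G\<^sup>k(X, Y)\<close>.\<close>

definition dirderiv ::
  "(real ^ 'm::finite \<Rightarrow> real ^ 'm) \<Rightarrow> (real ^ 'm \<Rightarrow> 'f::real_normed_vector) \<Rightarrow> real ^ 'm \<Rightarrow> 'f"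
  where
  "dirderiv X f = (\<lambda>x. frechet_derivative f (at x) (X x))"

definition lie_bracket ::
  "(real ^ 'm::finite \<Rightarrow> real ^ 'm) \<Rightarrow> (real ^ 'm \<Rightarrow> real ^ 'm) \<Rightarrow> real ^ 'm \<Rightarrow> real ^ 'm" where
  "lie_bracket X Y = (\<lambda>x. dirderiv X Y x - dirderiv Y X x)"

definition covd ::
  "(real ^ 'm::finite \<Rightarrow> real ^ 'm \<Rightarrow> real ^ 'm \<Rightarrow> real ^ 'm) \<Rightarrow>
   (real ^ 'm \<Rightarrow> real ^ 'm) \<Rightarrow> (real ^ 'm \<Rightarrow> real ^ 'm) \<Rightarrow> real ^ 'm \<Rightarrow> real ^ 'm" where
  "covd G X Y = (\<lambda>x. dirderiv X Y x + G x (X x) (Y x))"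

definition curvature ::
  "(real ^ 'm::finite \<Rightarrow> real ^ 'm \<Rightarrow> real ^ 'm \<Rightarrow> real ^ 'm) \<Rightarrow>
   (real ^ 'm \<Rightarrow> real ^ 'm) \<Rightarrow> (real ^ 'm \<Rightarrow> real ^ 'm) \<Rightarrow> (real ^ 'm \<Rightarrow> real ^ 'm) \<Rightarrow>
   real ^ 'm \<Rightarrow> real ^ 'm" where
  "curvature G X Y Z = (\<lambda>x.
     covd G X (covd G Y Z) x - covd G Y (covd G X Z) x - covd G (lie_bracket X Y) Z x)"

definition affine_connection :: "('a, 'm::finite) chart set \<Rightarrow> ('a, 'm) conn \<Rightarrow> bool" where
  "affine_connection A \<Gamma> \<longleftrightarrow>
     (\<forall>c\<in>A. (\<forall>x\<in>chart_image c. bilinear (\<Gamma> c x)) \<and>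
        (\<forall>u v. smooth_on (chart_image c) (\<lambda>x. \<Gamma> c x u v))) \<and>
     (\<forall>c\<in>A. \<forall>c'\<in>A. \<forall>x\<in>overlap c c'. \<forall>u v.
        \<Gamma> c' (transition c c' x) (tangent_transition c c' x u) (tangent_transition c c' x v) =
          tangent_transition c c' x (\<Gamma> c x u v) -
          frechet_derivative (\<lambda>y. tangent_transition c c' y v) (at x) u)"

text \<open>Torsion-free and metric. Identities between tensor fields are stated, here and below, for
  all smooth vector fields on each coordinate domain.\<close>

definition levi_civita ::
  "('a, 'm::finite) chart set \<Rightarrow> ('a, 'm) form2 \<Rightarrow> ('a, 'm) conn \<Rightarrow> bool" where
  "levi_civita A g \<Gamma> \<longleftrightarrow>
     affine_connection A \<Gamma> \<and>
     (\<forall>c\<in>A. \<forall>X Y Z.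
        smooth_on (chart_image c) X \<and> smooth_on (chart_image c) Y \<and>
        smooth_on (chart_image c) Z \<longrightarrow>
        (\<forall>x\<in>chart_image c.
           covd (\<Gamma> c) X Y x - covd (\<Gamma> c) Y X x = lie_bracket X Y x \<and>
           dirderiv X (\<lambda>y. g c y (Y y) (Z y)) x =
             g c x (covd (\<Gamma> c) X Y x) (Z x) + g c x (Y x) (covd (\<Gamma> c) X Z x)))"

definition lie_derivative_metric ::
  "(real ^ 'm::finite \<Rightarrow> real ^ 'm) \<Rightarrow> (real ^ 'm \<Rightarrow> real ^ 'm \<Rightarrow> real ^ 'm \<Rightarrow> real) \<Rightarrow>
   (real ^ 'm \<Rightarrow> real ^ 'm) \<Rightarrow> (real ^ 'm \<Rightarrow> real ^ 'm) \<Rightarrow> real ^ 'm \<Rightarrow> real" where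
  "lie_derivative_metric V h X Y = (\<lambda>x.
     dirderiv V (\<lambda>y. h y (X y) (Y y)) x -
     h x (lie_bracket V X x) (Y x) - h x (X x) (lie_bracket V Y x))"


section \<open>Kenmotsu manifolds\<close>

definition almost_contact_metric ::
  "('a, 'm::finite) chart set \<Rightarrow> ('a, 'm) endo \<Rightarrow> ('a, 'm) vfield \<Rightarrow> ('a, 'm) form1 \<Rightarrow>
   ('a, 'm) form2 \<Rightarrow> bool" where
  "almost_contact_metric A \<phi> \<xi> \<eta> g \<longleftrightarrow>
     endo_field A \<phi> \<and> vector_field A \<xi> \<and> one_form A \<eta> \<and> riemannian_metric A g \<and>
     (\<forall>c\<in>A. \<forall>x\<in>chart_image c.
        \<eta> c x (\<xi> c x) = 1 \<and>
        (\<forall>u. \<phi> c x (\<phi> c x u) = - u + \<eta> c x u *\<^sub>R \<xi> c x) \<and>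
        (\<forall>u v. g c x (\<phi> c x u) (\<phi> c x v) = g c x u v - \<eta> c x u * \<eta> c x v))"

text \<open>The left-hand side of the last equation is \<open>(\<nabla>\<^sub>X \<phi>) Y = \<nabla>\<^sub>X (\<phi> Y) - \<phi> (\<nabla>\<^sub>X Y)\<close>.\<close>

definition kenmotsu ::
  "'a topology \<Rightarrow> ('a, 'm::finite) chart set \<Rightarrow> ('a, 'm) endo \<Rightarrow> ('a, 'm) vfield \<Rightarrow>
   ('a, 'm) form1 \<Rightarrow> ('a, 'm) form2 \<Rightarrow> ('a, 'm) conn \<Rightarrow> bool" where
  "kenmotsu M A \<phi> \<xi> \<eta> g \<Gamma> \<longleftrightarrow>
     smooth_manifold M A \<and> almost_contact_metric A \<phi> \<xi> \<eta> g \<and> levi_civita A g \<Gamma> \<and>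
     (\<forall>c\<in>A. \<forall>X Y. smooth_on (chart_image c) X \<and> smooth_on (chart_image c) Y \<longrightarrow>
        (\<forall>x\<in>chart_image c.
           covd (\<Gamma> c) X (\<lambda>y. \<phi> c y (Y y)) x - \<phi> c x (covd (\<Gamma> c) X Y x) =
             g c x (\<phi> c x (X x)) (Y x) *\<^sub>R \<xi> c x - \<eta> c x (Y x) *\<^sub>R \<phi> c x (X x)))"

text \<open>\<open>Ric\<^sup>*(X, Y) = 1/2 Tr (\<phi> \<circ> R(X, \<phi> Y))\<close>. As \<open>R\<close> is tensorial, the trace at \<open>x\<close> may be
  computed by extending tangent vectors \<open>z\<close> at \<open>x\<close> to vector fields with constant components.\<close>

definition star_ricci ::
  "(real ^ 'm::finite \<Rightarrow> real ^ 'm \<Rightarrow> real ^ 'm \<Rightarrow> real ^ 'm) \<Rightarrow>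
   (real ^ 'm \<Rightarrow> real ^ 'm \<Rightarrow> real ^ 'm) \<Rightarrow>
   (real ^ 'm \<Rightarrow> real ^ 'm) \<Rightarrow> (real ^ 'm \<Rightarrow> real ^ 'm) \<Rightarrow> real ^ 'm \<Rightarrow> real" where
  "star_ricci G F X Y = (\<lambda>x.
     1 / 2 * trace (matrix (\<lambda>z. F x (curvature G X (\<lambda>y. F y (Y y)) (\<lambda>_. z) x))))"

definition almost_star_ricci_soliton ::
  "('a, 'm::finite) chart set \<Rightarrow> ('a, 'm) endo \<Rightarrow> ('a, 'm) form2 \<Rightarrow> ('a, 'm) conn \<Rightarrow>
   ('a, 'm) vfield \<Rightarrow> ('a \<Rightarrow> real) \<Rightarrow> bool" where
  "almost_star_ricci_soliton A \<phi> g \<Gamma> V lam \<longleftrightarrow>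
     vector_field A V \<and> smooth_function A lam \<and>
     (\<forall>c\<in>A. \<forall>X Y. smooth_on (chart_image c) X \<and> smooth_on (chart_image c) Y \<longrightarrow>
        (\<forall>x\<in>chart_image c.
           1 / 2 * lie_derivative_metric (V c) (g c) X Y x + star_ricci (\<Gamma> c) (\<phi> c) X Y x =
             lam (chart_inv c x) * g c x (X x) (Y x)))"

definition steady_star_ricci_soliton ::
  "'a topology \<Rightarrow> ('a, 'm::finite) chart set \<Rightarrow> ('a, 'm) endo \<Rightarrow> ('a, 'm) form2 \<Rightarrow>
   ('a, 'm) conn \<Rightarrow> ('a, 'm) vfield \<Rightarrow> ('a \<Rightarrow> real) \<Rightarrow> bool" where
  "steady_star_ricci_soliton M A \<phi> g \<Gamma> V lam \<longleftrightarrow>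
     almost_star_ricci_soliton A \<phi> g \<Gamma> V lam \<and> (\<forall>p\<in>topspace M. lam p = 0)"

definition jacobi_along ::
  "('a, 'm::finite) chart set \<Rightarrow> ('a, 'm) conn \<Rightarrow> ('a, 'm) vfield \<Rightarrow> ('a, 'm) vfield \<Rightarrow> bool" where
  "jacobi_along A \<Gamma> \<xi> V \<longleftrightarrow>
     (\<forall>c\<in>A. \<forall>x\<in>chart_image c.
        covd (\<Gamma> c) (\<xi> c) (covd (\<Gamma> c) (\<xi> c) (V c)) x +
        curvature (\<Gamma> c) (V c) (\<xi> c) (\<xi> c) x = 0)"

end

(* All computations take place in one coordinate domain. Put W = [\<xi>, V] and
   \<gamma> = g - \<eta> \<otimes> \<eta>, and let L_X denote the Lie derivative. On a Kenmotsu manifold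
   \<nabla>_X \<xi> = X - \<eta>(X) \<xi>, so the Jacobi equation amounts to [\<xi>, W] = 2 \<eta>(W) \<xi> - 2 W; the soliton
   equation on (\<xi>, \<xi>) gives \<eta>(W) = \<lambda>, and applying \<eta> to the former equation gives \<xi>(\<lambda>) = 0.
   Moreover L_\<xi> \<gamma> = 2 \<gamma>, L_\<xi> \<phi> = 0 and (L_\<xi> \<nabla>)(X, Y) = -2 \<gamma>(X, Y) \<xi>, whence L_\<xi> Ric* = -2 \<gamma>.
   On vector fields orthogonal to \<xi>, the soliton equation reads L_V \<gamma> = 2 \<lambda> \<gamma> - 2 Ric*. Applying
   L_\<xi> once gives L_W \<gamma> = 4 \<gamma> + 4 Ric*, and once more L_[\<xi>, W] \<gamma> = -8 \<gamma> - 8 Ric*. But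
   [\<xi>, W] = 2 \<lambda> \<xi> - 2 W also gives L_[\<xi>, W] \<gamma> = 4 \<lambda> \<gamma> - 8 \<gamma> - 8 Ric*, so \<lambda> = 0. *)

theory Submission
  imports Defs
begin

section \<open>Calculus of smooth maps\<close>

text \<open>Because \<open>S\<close> is open, a derivative at a point of \<open>S\<close> depends
  only on values in \<open>S\<close>, so agreement on \<open>S\<close> passes to every iterated
  derivative.\<close>

lemma Ck_on_cong:
  assumes "open S" "\<And>x. x \<in> S \<Longrightarrow> f x = h x" "Ck_on k S f"
  shows "Ck_on k S h"
  using assms(2,3)
proof (induction k arbitrary: f h)
  case 0
  then show ?case by (simp cong: continuous_on_cong)
next
  case (Suc k)
  have "h differentiable (at x)" "frechet_derivative f (at x) = frechet_derivative h (at x)"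
    if "x \<in> S" for x
  proof -
    have "(f has_derivative frechet_derivative f (at x)) (at x)"
      using Suc.prems(2) that by (simp add: frechet_derivative_works)
    then have "(h has_derivative frechet_derivative f (at x)) (at x)"
      using Suc.prems(1) by (rule has_derivative_transform_within_open[OF _ assms(1) that])
    then show "h differentiable (at x)" "frechet_derivative f (at x) = frechet_derivative h (at x)"
      by (auto simp: differentiable_def dest: frechet_derivative_at)
  qed
  moreover have "Ck_on k S (\<lambda>x. frechet_derivative h (at x) u)" for u
    by (rule Suc.IH[where f = "\<lambda>x. frechet_derivative f (at x) u"])
      (use Suc.prems(2) calculation in auto)
  ultimately show ?case by simp
qed

lemma smooth_on_cong:
  assumes "open S" "\<And>x. x \<in> S \<Longrightarrow> f x = h x" "smooth_on S f"
  shows "smooth_on S h"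
  using assms Ck_on_cong unfolding smooth_on_def by blast

lemma smooth_on_differentiable:
  assumes "smooth_on S f" "x \<in> S"
  shows "f differentiable (at x)"
  using assms unfolding smooth_on_def by (metis Ck_on.simps(2))

lemma smooth_on_frechet_derivative:
  assumes "smooth_on S f"
  shows "smooth_on S (\<lambda>x. frechet_derivative f (at x) u)"
  using assms unfolding smooth_on_def by (metis Ck_on.simps(2))

lemma smooth_on_continuous: "smooth_on S f \<Longrightarrow> continuous_on S f"
  unfolding smooth_on_def by (metis Ck_on.simps(1))

lemma smooth_on_has_derivative:
  "smooth_on S f \<Longrightarrow> x \<in> S \<Longrightarrow> (f has_derivative frechet_derivative f (at x)) (at x)"
  using smooth_on_differentiable frechet_derivative_works by blast

section \<open>Stability of smoothness under sums, linear maps and products\<close>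

lemma smooth_on_const: "smooth_on S (\<lambda>x. c)"
proof -
  have "Ck_on k S (\<lambda>x. c)" for k
    by (induction k arbitrary: c) auto
  then show ?thesis by (simp add: smooth_on_def)
qed

lemma Ck_on_add:
  assumes "open S" "Ck_on k S f" "Ck_on k S h"
  shows "Ck_on k S (\<lambda>x. f x + h x)"
  using assms(2,3)
proof (induction k arbitrary: f h)
  case 0
  then show ?case by (simp add: continuous_on_add)
next
  case (Suc k)
  have D: "frechet_derivative (\<lambda>x. f x + h x) (at x)
      = (\<lambda>u. frechet_derivative f (at x) u + frechet_derivative h (at x) u)" if "x \<in> S" for x
    using Suc.prems that
    by (intro frechet_derivative_at[symmetric] has_derivative_add)
      (auto simp: frechet_derivative_works)
  have "Ck_on k S (\<lambda>x. frechet_derivative (\<lambda>x. f x + h x) (at x) u)" for u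
    by (rule Ck_on_cong[OF assms(1) _ Suc.IH[of "\<lambda>x. frechet_derivative f (at x) u"
            "\<lambda>x. frechet_derivative h (at x) u"]])
      (use Suc.prems D in auto)
  then show ?case using Suc.prems by simp
qed

lemma smooth_on_add:
  "open S \<Longrightarrow> smooth_on S f \<Longrightarrow> smooth_on S h \<Longrightarrow> smooth_on S (\<lambda>x. f x + h x)"
  unfolding smooth_on_def by (simp add: Ck_on_add)

lemma smooth_on_bounded_linear:
  assumes "open S" "bounded_linear p" "smooth_on S f"
  shows "smooth_on S (\<lambda>x. p (f x))"
proof -
  have "Ck_on k S (\<lambda>x. p (f x))" if "smooth_on S f" for k f
    using that
  proof (induction k arbitrary: f)
    case 0
    then show ?case
      using smooth_on_continuous bounded_linear.continuous_on[OF assms(2)] by auto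
  next
    case (Suc k)
    have d: "((\<lambda>x. p (f x)) has_derivative (\<lambda>u. p (frechet_derivative f (at x) u))) (at x)"
      if "x \<in> S" for x
      by (rule bounded_linear.has_derivative[OF assms(2) smooth_on_has_derivative[OF Suc.prems that]])
    have e: "frechet_derivative (\<lambda>x. p (f x)) (at x) u = p (frechet_derivative f (at x) u)"
      if "x \<in> S" for x u
      by (simp flip: frechet_derivative_at[OF d[OF that]])
    have "Ck_on k S (\<lambda>x. frechet_derivative (\<lambda>x. p (f x)) (at x) u)" for u
      by (rule Ck_on_cong[OF assms(1) _ Suc.IH[OF smooth_on_frechet_derivative[OF Suc.prems]]])
        (simp add: e)
    then show ?case using d by (auto simp: differentiable_def)
  qed
  then show ?thesis using assms(3) by (simp add: smooth_on_def)
qed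

lemma smooth_on_bilinear:
  assumes "open S" "bounded_bilinear p" "smooth_on S f" "smooth_on S h"
  shows "smooth_on S (\<lambda>x. p (f x) (h x))"
proof -
  \<comment> \<open>The induction keeps smoothness of all orders as its hypothesis: each term of the
    product rule has one differentiated and one untouched factor, both again smooth, so no order has
    to be traded.\<close>
  have "Ck_on k S (\<lambda>x. p (f x) (h x))" if "smooth_on S f" "smooth_on S h" for k f h
    using that
  proof (induction k arbitrary: f h)
    case 0
    then show ?case
      by (simp add: smooth_on_continuous bounded_bilinear.continuous_on[OF assms(2)])
  next
    case (Suc k)
    have d: "((\<lambda>x. p (f x) (h x)) has_derivative
        (\<lambda>u. p (f x) (frechet_derivative h (at x) u) + p (frechet_derivative f (at x) u) (h x))) (at x)"
      if "x \<in> S" for x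
      by (rule bounded_bilinear.FDERIV[OF assms(2) smooth_on_has_derivative[OF Suc.prems(1) that]
            smooth_on_has_derivative[OF Suc.prems(2) that]])
    have e: "frechet_derivative (\<lambda>x. p (f x) (h x)) (at x) u =
        p (f x) (frechet_derivative h (at x) u) + p (frechet_derivative f (at x) u) (h x)"
      if "x \<in> S" for x u
      by (simp flip: frechet_derivative_at[OF d[OF that]])
    have "Ck_on k S (\<lambda>x. frechet_derivative (\<lambda>x. p (f x) (h x)) (at x) u)" for u
      by (rule Ck_on_cong[OF assms(1) _ Ck_on_add[OF assms(1)
              Suc.IH[OF Suc.prems(1) smooth_on_frechet_derivative[OF Suc.prems(2)]]
              Suc.IH[OF smooth_on_frechet_derivative[OF Suc.prems(1)] Suc.prems(2)]]])
        (simp add: e)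
    then show ?case using d by (auto simp: differentiable_def)
  qed
  then show ?thesis using assms(3,4) by (simp add: smooth_on_def)
qed

lemma smooth_on_sum:
  assumes "open S" "\<And>i. i \<in> I \<Longrightarrow> smooth_on S (f i)"
  shows "smooth_on S (\<lambda>x. \<Sum>i\<in>I. f i x)"
  using assms(2)
  by (induction I rule: infinite_finite_induct)
    (auto intro!: smooth_on_const smooth_on_add[OF assms(1)])

section \<open>Symmetry of mixed second derivatives\<close>

text \<open>The second difference quotient of \<open>f\<close> along \<open>u\<close>, \<open>v\<close> is, by two applications of the mean
  value theorem, a value of \<open>D\<^sub>v D\<^sub>u f\<close> near \<open>x\<close>; it is symmetric in \<open>u\<close> and \<open>v\<close>.\<close>

lemma second_difference:
  fixes f :: "'e::real_normed_vector \<Rightarrow> real"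
  assumes f: "smooth_on (ball x e) f" and s: "0 < s" "s * (norm u + norm v) < e"
  shows "\<exists>y\<in>cball x (s * (norm u + norm v)).
    f (x + s *\<^sub>R u + s *\<^sub>R v) - f (x + s *\<^sub>R u) - f (x + s *\<^sub>R v) + f x
      = s * s * frechet_derivative (\<lambda>z. frechet_derivative f (at z) u) (at y) v"
proof -
  have bound: "norm (a *\<^sub>R u + b *\<^sub>R v) \<le> s * (norm u + norm v)"
    if "0 \<le> a" "a \<le> s" "0 \<le> b" "b \<le> s" for a b
  proof -
    have "norm (a *\<^sub>R u + b *\<^sub>R v) \<le> a * norm u + b * norm v"
      using norm_triangle_ineq[of "a *\<^sub>R u" "b *\<^sub>R v"] that by simp
    also have "\<dots> \<le> s * norm u + s * norm v"
      using that by (intro add_mono mult_right_mono) auto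
    finally show ?thesis by (simp add: algebra_simps)
  qed
  have inb: "x + a *\<^sub>R u + b *\<^sub>R v \<in> cball x (s * (norm u + norm v))"
    if "0 \<le> a" "a \<le> s" "0 \<le> b" "b \<le> s" for a b
  proof -
    have "dist (x + (a *\<^sub>R u + b *\<^sub>R v)) x = norm (a *\<^sub>R u + b *\<^sub>R v)" by (simp add: dist_norm)
    then show ?thesis using bound[OF that] by (simp add: dist_commute add.assoc)
  qed
  have inU: "x + a *\<^sub>R u + b *\<^sub>R v \<in> ball x e"
    if "0 \<le> a" "a \<le> s" "0 \<le> b" "b \<le> s" for a b
    using inb[OF that] s by auto
  \<comment> \<open>\<open>?F\<close> is the first difference along \<open>v\<close>, so its
    increment over \<open>[0, s]\<close> is the second difference.\<close>
  let ?F = "\<lambda>a. f (x + a *\<^sub>R u + s *\<^sub>R v) - f (x + a *\<^sub>R u)"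
  let ?f' = "\<lambda>z. frechet_derivative f (at z) u"
  have lin: "linear (frechet_derivative f (at z))" if "z \<in> ball x e" for z
    using linear_frechet_derivative smooth_on_differentiable[OF f that] by blast
  have d1: "((\<lambda>a. f (x + a *\<^sub>R u + b *\<^sub>R v)) has_real_derivative ?f' (x + a *\<^sub>R u + b *\<^sub>R v)) (at a)"
    if "0 \<le> a" "a \<le> s" "0 \<le> b" "b \<le> s" for a b
  proof -
    have "((\<lambda>a. f (x + a *\<^sub>R u + b *\<^sub>R v)) has_derivative
        (\<lambda>h. frechet_derivative f (at (x + a *\<^sub>R u + b *\<^sub>R v)) (h *\<^sub>R u))) (at a)"
      by (rule has_derivative_compose[where f = "\<lambda>a. x + a *\<^sub>R u + b *\<^sub>R v"
            and f' = "\<lambda>h. h *\<^sub>R u", OF _ smooth_on_has_derivative[OF f inU[OF that]]])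
        (auto intro!: derivative_eq_intros)
    then show ?thesis
      by (rule has_derivative_imp_has_field_derivative)
        (simp add: linear_cmul[OF lin[OF inU[OF that]]])
  qed
  have "(?F has_real_derivative (?f' (x + a *\<^sub>R u + s *\<^sub>R v) - ?f' (x + a *\<^sub>R u))) (at a)"
    if "0 \<le> a" "a \<le> s" for a
    using DERIV_diff[OF d1[OF that, of s] d1[OF that, of 0]] s by simp
  from MVT2[OF s(1) this] obtain a where a: "0 < a" "a < s"
    and Fa: "?F s - ?F 0 = s * (?f' (x + a *\<^sub>R u + s *\<^sub>R v) - ?f' (x + a *\<^sub>R u))"
    by auto
  note f' = smooth_on_frechet_derivative[OF f, of u]
  have lin': "linear (frechet_derivative ?f' (at z))" if "z \<in> ball x e" for z
    using linear_frechet_derivative smooth_on_differentiable[OF f' that] by blast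
  have d2: "((\<lambda>b. ?f' (x + a *\<^sub>R u + b *\<^sub>R v)) has_real_derivative
      frechet_derivative ?f' (at (x + a *\<^sub>R u + b *\<^sub>R v)) v) (at b)" if "0 \<le> b" "b \<le> s" for b
  proof -
    have m: "x + a *\<^sub>R u + b *\<^sub>R v \<in> ball x e" using inU a that by simp
    have "((\<lambda>b. ?f' (x + a *\<^sub>R u + b *\<^sub>R v)) has_derivative
        (\<lambda>h. frechet_derivative ?f' (at (x + a *\<^sub>R u + b *\<^sub>R v)) (h *\<^sub>R v))) (at b)"
      by (rule has_derivative_compose[where f = "\<lambda>b. x + a *\<^sub>R u + b *\<^sub>R v"
            and f' = "\<lambda>h. h *\<^sub>R v", OF _ smooth_on_has_derivative[OF f' m]])
        (auto intro!: derivative_eq_intros)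
    then show ?thesis
      by (rule has_derivative_imp_has_field_derivative) (simp add: linear_cmul[OF lin'[OF m]])
  qed
  from MVT2[OF s(1) d2] obtain b where b: "0 < b" "b < s"
    and Gb: "?f' (x + a *\<^sub>R u + s *\<^sub>R v) - ?f' (x + a *\<^sub>R u + 0 *\<^sub>R v) =
      s * frechet_derivative ?f' (at (x + a *\<^sub>R u + b *\<^sub>R v)) v"
    by auto
  show ?thesis
  proof
    have "f (x + s *\<^sub>R u + s *\<^sub>R v) - f (x + s *\<^sub>R u) - f (x + s *\<^sub>R v) + f x = ?F s - ?F 0"
      by simp
    then show "f (x + s *\<^sub>R u + s *\<^sub>R v) - f (x + s *\<^sub>R u) - f (x + s *\<^sub>R v) + f x
        = s * s * frechet_derivative ?f' (at (x + a *\<^sub>R u + b *\<^sub>R v)) v"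
      using Fa Gb by simp
    show "x + a *\<^sub>R u + b *\<^sub>R v \<in> cball x (s * (norm u + norm v))"
      by (rule inb) (use a b in auto)
  qed
qed

lemma smooth_on_subset: "smooth_on S f \<Longrightarrow> T \<subseteq> S \<Longrightarrow> smooth_on T f"
proof -
  have "Ck_on k T f" if "Ck_on k S f" "T \<subseteq> S" for k
    using that by (induction k arbitrary: f) (auto intro: continuous_on_subset)
  then show "smooth_on S f \<Longrightarrow> T \<subseteq> S \<Longrightarrow> smooth_on T f" by (auto simp: smooth_on_def)
qed

text \<open>For one small \<open>s\<close> the same second difference equals both
  \<open>s * s * ?D u v y\<close> and \<open>s * s * ?D v u z\<close> with \<open>y\<close>,
  \<open>z\<close> near \<open>x\<close>; continuity of the second derivatives carries the equality
  to \<open>x\<close>.\<close>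

lemma second_derivative_symmetric_real:
  fixes f :: "'e::real_normed_vector \<Rightarrow> real"
  assumes "open S" "x \<in> S" "smooth_on S f"
  shows "frechet_derivative (\<lambda>y. frechet_derivative f (at y) u) (at x) v
    = frechet_derivative (\<lambda>y. frechet_derivative f (at y) v) (at x) u"
    (is "?D u v x = ?D v u x")
proof (rule ccontr)
  assume ne: "?D u v x \<noteq> ?D v u x"
  \<comment> \<open>Half the gap: values strictly within \<open>\<epsilon>\<close> of the two sides
    cannot coincide.\<close>
  define \<epsilon> where "\<epsilon> = \<bar>?D u v x - ?D v u x\<bar> / 2"
  have \<epsilon>: "\<epsilon> > 0" using ne by (simp add: \<epsilon>_def)
  have "isCont (?D a b) x" for a b
    using smooth_on_continuous[OF smooth_on_frechet_derivative[OF
          smooth_on_frechet_derivative[OF assms(3)]]]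
    by (simp add: continuous_on_eq_continuous_at[OF assms(1)] assms(2))
  then have "\<exists>d>0. \<forall>y. dist y x < d \<longrightarrow> dist (?D a b y) (?D a b x) < \<epsilon>" for a b
    using \<epsilon> unfolding continuous_at_eps_delta by simp
  from this[of u v] this[of v u] obtain d1 d2 where d: "d1 > 0" "d2 > 0"
    and d1: "\<And>y. dist y x < d1 \<Longrightarrow> dist (?D u v y) (?D u v x) < \<epsilon>"
    and d2: "\<And>y. dist y x < d2 \<Longrightarrow> dist (?D v u y) (?D v u x) < \<epsilon>"
    by auto
  obtain e where e: "e > 0" "ball x e \<subseteq> S" using assms(1,2) open_contains_ball by blast
  note f = smooth_on_subset[OF assms(3) e(2)]
  define m where "m = min e (min d1 d2)"
  have m: "m > 0" using e d by (simp add: m_def)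
  \<comment> \<open>The added 1 keeps \<open>N\<close> positive when \<open>u = v = 0\<close>. The
    resulting \<open>s\<close> makes \<open>s * (norm u + norm v) < m\<close>, which fits into the
    ball and into both neighbourhoods obtained from continuity.\<close>
  define N where "N = norm u + norm v + 1"
  have N: "N > 0" unfolding N_def by (intro add_nonneg_pos) auto
  define s where "s = m / (2 * N)"
  have s: "s > 0" using m N by (simp add: s_def)
  have "s * (norm u + norm v) \<le> s * N" using s by (simp add: N_def)
  also have "\<dots> = m / 2" using N by (simp add: s_def)
  also have "\<dots> < m" using m by simp
  finally have sm: "s * (norm u + norm v) < m" .
  then have se: "s * (norm u + norm v) < e" "s * (norm v + norm u) < e"
    by (auto simp: m_def add.commute)
  obtain y where y: "y \<in> cball x (s * (norm u + norm v))"
    "f (x + s *\<^sub>R u + s *\<^sub>R v) - f (x + s *\<^sub>R u) - f (x + s *\<^sub>R v) + f x = s * s * ?D u v y"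
    using second_difference[OF f s se(1)] by blast
  obtain z where z: "z \<in> cball x (s * (norm v + norm u))"
    "f (x + s *\<^sub>R v + s *\<^sub>R u) - f (x + s *\<^sub>R v) - f (x + s *\<^sub>R u) + f x = s * s * ?D v u z"
    using second_difference[OF f s se(2)] by blast
  have "s * s * ?D u v y = s * s * ?D v u z"
    using y(2) z(2) by (simp add: algebra_simps)
  then have "?D u v y = ?D v u z" using s by simp
  moreover have "dist (?D u v y) (?D u v x) < \<epsilon>"
    by (rule d1) (use y(1) sm in \<open>auto simp: m_def dist_commute\<close>)
  moreover have "dist (?D v u z) (?D v u x) < \<epsilon>"
    by (rule d2) (use z(1) sm in \<open>auto simp: m_def dist_commute add.commute\<close>)
  ultimately show False by (simp add: \<epsilon>_def dist_real_def abs_if split: if_splits)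
qed

lemma frechet_derivative_bounded_linear:
  assumes "bounded_linear p" "f differentiable (at x)"
  shows "frechet_derivative (\<lambda>y. p (f y)) (at x) u = p (frechet_derivative f (at x) u)"
  using bounded_linear.has_derivative[OF assms(1), of f] assms(2)
  by (metis frechet_derivative_at frechet_derivative_works)

text \<open>Differentiability is not assumed: both functions have the same candidates for a
  derivative, and \<open>frechet_derivative\<close> is a choice among these candidates.\<close>

lemma frechet_derivative_cong_open:
  assumes "open S" "x \<in> S" "\<And>y. y \<in> S \<Longrightarrow> f y = h y"
  shows "frechet_derivative f (at x) = frechet_derivative h (at x)"
proof -
  have "(f has_derivative D) (at x) \<longleftrightarrow> (h has_derivative D) (at x)" for D
    using has_derivative_transform_within_open[OF _ assms(1,2)] assms(3) by metis
  then show ?thesis by (simp add: frechet_derivative_def)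
qed

lemma second_derivative_symmetric:
  fixes f :: "'e::real_normed_vector \<Rightarrow> 'f::real_inner"
  assumes "open S" "x \<in> S" "smooth_on S f"
  shows "frechet_derivative (\<lambda>y. frechet_derivative f (at y) u) (at x) v
    = frechet_derivative (\<lambda>y. frechet_derivative f (at y) v) (at x) u"
    (is "?D u v = ?D v u")
proof -
  \<comment> \<open>The real case is applied to \<open>f\<close> paired with the defect
    \<open>w\<close> itself, which gives \<open>w \<bullet> w = 0\<close>.\<close>
  define w where "w = ?D u v - ?D v u"
  have *: "frechet_derivative (\<lambda>y. frechet_derivative (\<lambda>y. f y \<bullet> w) (at y) a) (at x) b = ?D a b \<bullet> w"
    for a b
  proof -
    have "frechet_derivative (\<lambda>y. frechet_derivative (\<lambda>y. f y \<bullet> w) (at y) a) (at x) b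
      = frechet_derivative (\<lambda>y. frechet_derivative f (at y) a \<bullet> w) (at x) b"
      by (intro fun_cong[OF frechet_derivative_cong_open[OF assms(1,2)]]
          frechet_derivative_bounded_linear[OF bounded_linear_inner_left]
          smooth_on_differentiable[OF assms(3)])
    also have "\<dots> = ?D a b \<bullet> w"
      by (rule frechet_derivative_bounded_linear[OF bounded_linear_inner_left
          smooth_on_differentiable[OF smooth_on_frechet_derivative[OF assms(3)] assms(2)]])
    finally show ?thesis .
  qed
  have "?D u v \<bullet> w = ?D v u \<bullet> w"
    using second_derivative_symmetric_real[OF assms(1,2)
        smooth_on_bounded_linear[OF assms(1) bounded_linear_inner_left assms(3), of w], of u v] *
    by metis
  then have "w \<bullet> w = 0" by (simp add: w_def inner_diff_left)
  then show ?thesis by (simp add: w_def)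
qed

section \<open>Vector fields on a coordinate domain\<close>

lemma linear_axis_expansion:
  fixes F :: "real ^ 'm::finite \<Rightarrow> 'f::real_vector"
  assumes "linear F"
  shows "F u = (\<Sum>i\<in>UNIV. (u $ i) *\<^sub>R F (axis i 1))"
proof -
  have "F u = F (\<Sum>i\<in>UNIV. (u $ i) *\<^sub>R axis i 1)"
    by (simp add: basis_expansion flip: scalar_mult_eq_scaleR)
  then show ?thesis by (simp add: linear_sum[OF assms] linear_cmul[OF assms])
qed

locale coordinate_domain =
  fixes U :: "(real ^ 'm::finite) set"
  assumes open_U: "open U"
begin

lemmas smooth_add = smooth_on_add[OF open_U]
  and smooth_sum = smooth_on_sum[OF open_U]
  and smooth_scaleR = smooth_on_bilinear[OF open_U bounded_bilinear_scaleR]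
  and smooth_mult = smooth_on_bilinear[OF open_U bounded_bilinear_mult]
  and smooth_minus = smooth_on_bounded_linear[OF open_U bounded_linear_minus[OF bounded_linear_ident]]
  and smooth_component = smooth_on_bounded_linear[OF open_U bounded_linear_vec_nth]

lemma smooth_diff: "smooth_on U f \<Longrightarrow> smooth_on U h \<Longrightarrow> smooth_on U (\<lambda>x. f x - h x)"
  using smooth_add[OF _ smooth_minus] by simp

text \<open>Expanding \<open>X\<close> along the axes turns the map into a finite sum of components
  of \<open>X\<close> times values of \<open>F\<close> on fixed vectors.\<close>

lemma smooth_apply:
  fixes X :: "real ^ 'm \<Rightarrow> real ^ 'k::finite"
  assumes "\<And>x. x \<in> U \<Longrightarrow> linear (F x)" "\<And>u. smooth_on U (\<lambda>x. F x u)" "smooth_on U X"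
  shows "smooth_on U (\<lambda>x. F x (X x))"
proof (rule smooth_on_cong[OF open_U])
  show "(\<Sum>i\<in>UNIV. (X x $ i) *\<^sub>R F x (axis i 1)) = F x (X x)" if "x \<in> U" for x
    using linear_axis_expansion[OF assms(1)[OF that]] by metis
  show "smooth_on U (\<lambda>x. \<Sum>i\<in>UNIV. (X x $ i) *\<^sub>R F x (axis i 1))"
    by (intro smooth_sum smooth_scaleR smooth_component assms)
qed

lemma smooth_apply2:
  fixes X :: "real ^ 'm \<Rightarrow> real ^ 'k::finite" and Y :: "real ^ 'm \<Rightarrow> real ^ 'l::finite"
  assumes "\<And>x. x \<in> U \<Longrightarrow> bilinear (B x)" "\<And>u v. smooth_on U (\<lambda>x. B x u v)"
    "smooth_on U X" "smooth_on U Y"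
  shows "smooth_on U (\<lambda>x. B x (X x) (Y x))"
  by (rule smooth_apply[where F = "\<lambda>x v. B x (X x) v"])
    (auto intro!: smooth_apply[where F = "\<lambda>x u. B x u _"] assms
      dest: assms(1) simp: bilinear_def)

section \<open>Directional derivatives and Lie brackets in coordinates\<close>

lemma smooth_dirderiv:
  assumes "smooth_on U X" "smooth_on U f"
  shows "smooth_on U (dirderiv X f)"
  unfolding dirderiv_def
  by (rule smooth_apply[OF _ smooth_on_frechet_derivative[OF assms(2)] assms(1)])
    (use linear_frechet_derivative smooth_on_differentiable[OF assms(2)] in blast)

lemma smooth_lie_bracket:
  "smooth_on U X \<Longrightarrow> smooth_on U Y \<Longrightarrow> smooth_on U (lie_bracket X Y)"
  unfolding lie_bracket_def by (intro smooth_diff smooth_dirderiv)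

lemmas smooth_intros = smooth_on_const smooth_add smooth_diff smooth_minus smooth_sum smooth_scaleR
  smooth_mult smooth_component smooth_dirderiv smooth_lie_bracket

lemma dirderiv_cong:
  assumes "x \<in> U" "\<And>y. y \<in> U \<Longrightarrow> f y = h y" "X x = Y x"
  shows "dirderiv X f x = dirderiv Y h x"
  unfolding dirderiv_def using frechet_derivative_cong_open[OF open_U assms(1,2)] assms(3) by simp

lemma dirderiv_const [simp]: "dirderiv X (\<lambda>y. c) x = 0"
  by (simp add: dirderiv_def)

context
  fixes x
  assumes x: "x \<in> U"
begin

lemma dirderiv_add:
  assumes "smooth_on U f" "smooth_on U h"
  shows "dirderiv X (\<lambda>y. f y + h y) x = dirderiv X f x + dirderiv X h x"
  unfolding dirderiv_def
  by (subst frechet_derivative_at[OF has_derivative_add[OF smooth_on_has_derivative[OF assms(1) x]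
          smooth_on_has_derivative[OF assms(2) x]], symmetric]) simp

lemma dirderiv_diff:
  assumes "smooth_on U f" "smooth_on U h"
  shows "dirderiv X (\<lambda>y. f y - h y) x = dirderiv X f x - dirderiv X h x"
  unfolding dirderiv_def
  by (subst frechet_derivative_at[OF has_derivative_diff[OF smooth_on_has_derivative[OF assms(1) x]
          smooth_on_has_derivative[OF assms(2) x]], symmetric]) simp

lemma dirderiv_bilinear:
  assumes "bounded_bilinear p" "smooth_on U f" "smooth_on U h"
  shows "dirderiv X (\<lambda>y. p (f y) (h y)) x = p (f x) (dirderiv X h x) + p (dirderiv X f x) (h x)"
  unfolding dirderiv_def
  by (subst frechet_derivative_at[OF bounded_bilinear.FDERIV[OF assms(1)
          smooth_on_has_derivative[OF assms(2) x] smooth_on_has_derivative[OF assms(3) x]],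
        symmetric]) simp

lemmas dirderiv_mult = dirderiv_bilinear[OF bounded_bilinear_mult]
  and dirderiv_scaleR = dirderiv_bilinear[OF bounded_bilinear_scaleR]

lemma dirderiv_bounded_linear:
  assumes "bounded_linear p" "smooth_on U f"
  shows "dirderiv X (\<lambda>y. p (f y)) x = p (dirderiv X f x)"
  unfolding dirderiv_def
  by (rule frechet_derivative_bounded_linear[OF assms(1) smooth_on_differentiable[OF assms(2) x]])

lemma dirderiv_sum:
  assumes "\<And>i. i \<in> I \<Longrightarrow> smooth_on U (f i)"
  shows "dirderiv X (\<lambda>y. \<Sum>i\<in>I. f i y) x = (\<Sum>i\<in>I. dirderiv X (f i) x)"
  using assms
  by (induction I rule: infinite_finite_induct) (auto simp: dirderiv_add smooth_sum)

lemma linear_derivative: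
  "smooth_on U f \<Longrightarrow> linear (frechet_derivative f (at x))"
  by (rule linear_frechet_derivative[OF smooth_on_differentiable[OF _ x]])

lemma dirderiv_field_add:
  "smooth_on U f \<Longrightarrow> dirderiv (\<lambda>y. X y + Y y) f x = dirderiv X f x + dirderiv Y f x"
  by (simp add: dirderiv_def linear_add[OF linear_derivative])

lemma dirderiv_field_diff:
  "smooth_on U f \<Longrightarrow> dirderiv (\<lambda>y. X y - Y y) f x = dirderiv X f x - dirderiv Y f x"
  by (simp add: dirderiv_def linear_diff[OF linear_derivative])

lemma dirderiv_field_scaleR:
  "smooth_on U f \<Longrightarrow> dirderiv (\<lambda>y. a y *\<^sub>R X y) f x = a x *\<^sub>R dirderiv X f x"
  by (simp add: dirderiv_def linear_cmul[OF linear_derivative])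

text \<open>Differentiating the axis expansion of \<open>Y\<close> separates a first-order term from
  the Hessian of \<open>f\<close> contracted with \<open>X\<close> and \<open>Y\<close>; only the
  first-order term survives in a commutator.\<close>

lemma dirderiv_dirderiv:
  assumes "smooth_on U Y" "smooth_on U f"
  shows "dirderiv X (dirderiv Y f) x = frechet_derivative f (at x) (dirderiv X Y x) +
    (\<Sum>i\<in>UNIV. \<Sum>j\<in>UNIV. (X x $ j * Y x $ i) *\<^sub>R
      frechet_derivative (\<lambda>y. frechet_derivative f (at y) (axis i 1)) (at x) (axis j 1))"
proof -
  let ?D = "\<lambda>i y. frechet_derivative f (at y) (axis i 1)"
  have D: "smooth_on U (?D i)" for i
    by (rule smooth_on_frechet_derivative[OF assms(2)])
  have Y: "smooth_on U (\<lambda>y. Y y $ i)" for i by (rule smooth_component[OF assms(1)])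
  have "dirderiv X (dirderiv Y f) x = dirderiv X (\<lambda>y. \<Sum>i\<in>UNIV. (Y y $ i) *\<^sub>R ?D i y) x"
  proof (rule dirderiv_cong[OF x _ refl])
    fix y assume "y \<in> U"
    then have "linear (frechet_derivative f (at y))"
      by (rule linear_frechet_derivative[OF smooth_on_differentiable[OF assms(2)]])
    then show "dirderiv Y f y = (\<Sum>i\<in>UNIV. (Y y $ i) *\<^sub>R ?D i y)"
      unfolding dirderiv_def by (rule linear_axis_expansion)
  qed
  also have "\<dots> = (\<Sum>i\<in>UNIV. (Y x $ i) *\<^sub>R dirderiv X (?D i) x + (dirderiv X Y x $ i) *\<^sub>R ?D i x)"
    by (simp add: dirderiv_sum smooth_scaleR D Y dirderiv_scaleR
        dirderiv_bounded_linear[OF bounded_linear_vec_nth assms(1)])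
  also have "\<dots> = frechet_derivative f (at x) (dirderiv X Y x) +
      (\<Sum>i\<in>UNIV. (Y x $ i) *\<^sub>R dirderiv X (?D i) x)"
    by (subst linear_axis_expansion[OF linear_derivative[OF assms(2)], of "dirderiv X Y x"])
      (simp add: sum.distrib)
  also have "(\<Sum>i\<in>UNIV. (Y x $ i) *\<^sub>R dirderiv X (?D i) x) = (\<Sum>i\<in>UNIV. \<Sum>j\<in>UNIV.
      (X x $ j * Y x $ i) *\<^sub>R frechet_derivative (?D i) (at x) (axis j 1))"
    unfolding dirderiv_def
    by (subst linear_axis_expansion[OF linear_derivative[OF D]])
      (simp add: scaleR_sum_right mult.commute)
  finally show ?thesis .
qed

text \<open>The Hessian parts of the two compositions agree by symmetry of second derivatives and
  cancel.\<close>

lemma dirderiv_lie_bracket: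
  fixes f :: "real ^ 'm \<Rightarrow> 'f::real_inner"
  assumes "smooth_on U X" "smooth_on U Y" "smooth_on U f"
  shows "dirderiv (lie_bracket X Y) f x = dirderiv X (dirderiv Y f) x - dirderiv Y (dirderiv X f) x"
proof -
  let ?H = "\<lambda>i j. frechet_derivative (\<lambda>y. frechet_derivative f (at y) (axis i 1)) (at x) (axis j 1)"
  have "(\<Sum>i\<in>UNIV. \<Sum>j\<in>UNIV. (X x $ j * Y x $ i) *\<^sub>R ?H i j)
      = (\<Sum>j\<in>UNIV. \<Sum>i\<in>UNIV. (X x $ j * Y x $ i) *\<^sub>R ?H i j)"
    by (rule sum.swap)
  also have "\<dots> = (\<Sum>j\<in>UNIV. \<Sum>i\<in>UNIV. (Y x $ i * X x $ j) *\<^sub>R ?H j i)"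
    using second_derivative_symmetric[OF open_U x assms(3)]
    by (intro sum.cong refl) (metis mult.commute)
  finally show ?thesis
    using linear_diff[OF linear_derivative[OF assms(3)]]
    by (simp add: dirderiv_dirderiv assms)
      (simp add: dirderiv_def lie_bracket_def)
qed

lemma lie_bracket_cong:
  assumes "\<And>y. y \<in> U \<Longrightarrow> X y = X' y" "\<And>y. y \<in> U \<Longrightarrow> Y y = Y' y"
  shows "lie_bracket X Y x = lie_bracket X' Y' x"
  unfolding lie_bracket_def by (intro arg_cong2[of _ _ _ _ "(-)"] dirderiv_cong[OF x] assms x)

lemma lie_bracket_add:
  assumes "smooth_on U X" "smooth_on U Y" "smooth_on U Z"
  shows "lie_bracket X (\<lambda>y. Y y + Z y) x = lie_bracket X Y x + lie_bracket X Z x"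
  by (simp add: lie_bracket_def dirderiv_add dirderiv_field_add assms)

lemma lie_bracket_diff:
  assumes "smooth_on U X" "smooth_on U Y" "smooth_on U Z"
  shows "lie_bracket X (\<lambda>y. Y y - Z y) x = lie_bracket X Y x - lie_bracket X Z x"
  by (simp add: lie_bracket_def dirderiv_diff dirderiv_field_diff assms)

lemma lie_bracket_scaleR:
  assumes "smooth_on U X" "smooth_on U Y" "smooth_on U a"
  shows "lie_bracket X (\<lambda>y. a y *\<^sub>R Y y) x = dirderiv X a x *\<^sub>R Y x + a x *\<^sub>R lie_bracket X Y x"
  by (simp add: lie_bracket_def dirderiv_scaleR dirderiv_field_scaleR assms algebra_simps)

lemma lie_bracket_commute: "lie_bracket Y X x = - lie_bracket X Y x"
  by (simp add: lie_bracket_def)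

text \<open>Each bracket opens into iterated directional derivatives, and a derivative along a
  bracket is a commutator; the resulting third-level terms cancel in pairs.\<close>

lemma jacobi_identity:
  assumes "smooth_on U X" "smooth_on U Y" "smooth_on U Z"
  shows "lie_bracket X (lie_bracket Y Z) x =
    lie_bracket (lie_bracket X Y) Z x + lie_bracket Y (lie_bracket X Z) x"
proof -
  have 1: "dirderiv A (lie_bracket B C) x = dirderiv A (dirderiv B C) x - dirderiv A (dirderiv C B) x"
    if "smooth_on U A" "smooth_on U B" "smooth_on U C" for A B C
    using that by (subst lie_bracket_def) (simp add: dirderiv_diff smooth_dirderiv)
  have 2: "lie_bracket A (lie_bracket B C) x = dirderiv A (lie_bracket B C) x -
      dirderiv (lie_bracket B C) A x"
    "lie_bracket (lie_bracket B C) A x = dirderiv (lie_bracket B C) A x -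
      dirderiv A (lie_bracket B C) x" for A B C
    by (simp_all add: lie_bracket_def)
  show ?thesis using assms by (simp add: 2 1 dirderiv_lie_bracket)
qed

section \<open>Lie derivatives of bilinear forms\<close>

text \<open>This is \<open>L_V L_W h = L_W L_V h + L_[V,W] h\<close> evaluated on \<open>X\<close>
  and \<open>Y\<close>. The scalar part is the commutator rule for derivations, the bracket terms
  are the Jacobi identity, and mixed terms occur symmetrically in \<open>V\<close> and
  \<open>W\<close>.\<close>

lemma lie_derivative_metric_commutator:
  assumes h: "\<And>y. y \<in> U \<Longrightarrow> bilinear (h y)" "\<And>u v. smooth_on U (\<lambda>y. h y u v)"
    and [simp]: "smooth_on U V" "smooth_on U W" "smooth_on U X" "smooth_on U Y"
  shows "dirderiv V (lie_derivative_metric W h X Y) x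
      - lie_derivative_metric W h (lie_bracket V X) Y x
      - lie_derivative_metric W h X (lie_bracket V Y) x =
    dirderiv W (lie_derivative_metric V h X Y) x
      - lie_derivative_metric V h (lie_bracket W X) Y x
      - lie_derivative_metric V h X (lie_bracket W Y) x
      + lie_derivative_metric (lie_bracket V W) h X Y x"
proof -
  have s [simp]: "smooth_on U (\<lambda>y. h y (A y) (B y))" if "smooth_on U A" "smooth_on U B" for A B
    by (rule smooth_apply2[OF h that])
  have 1: "dirderiv A (lie_derivative_metric B h X Y) x = dirderiv A (dirderiv B (\<lambda>y. h y (X y) (Y y))) x
      - dirderiv A (\<lambda>y. h y (lie_bracket B X y) (Y y)) x
      - dirderiv A (\<lambda>y. h y (X y) (lie_bracket B Y y)) x"
    if "smooth_on U A" "smooth_on U B" for A B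
    using that by (simp add: lie_derivative_metric_def dirderiv_diff smooth_intros)
  have 2: "h x (lie_bracket (lie_bracket V W) A x) B
      = h x (lie_bracket V (lie_bracket W A) x) B - h x (lie_bracket W (lie_bracket V A) x) B"
    "h x B (lie_bracket (lie_bracket V W) A x)
      = h x B (lie_bracket V (lie_bracket W A) x) - h x B (lie_bracket W (lie_bracket V A) x)"
    if "smooth_on U A" for A B
    using jacobi_identity[of V W A] that
    by (simp_all add: bilinear_ladd[OF h(1)[OF x]] bilinear_radd[OF h(1)[OF x]])
  show ?thesis
    by (simp add: 1)
      (simp add: lie_derivative_metric_def dirderiv_lie_bracket 2)
qed

lemma lie_derivative_metric_add:
  assumes "bilinear (h x)" "\<And>A B. smooth_on U A \<Longrightarrow> smooth_on U B \<Longrightarrow> smooth_on U (\<lambda>y. h y (A y) (B y))"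
    "smooth_on U V" "smooth_on U W" "smooth_on U X" "smooth_on U Y"
  shows "lie_derivative_metric (\<lambda>y. V y + W y) h X Y x =
    lie_derivative_metric V h X Y x + lie_derivative_metric W h X Y x"
  using assms
  by (simp add: lie_derivative_metric_def lie_bracket_commute[of "\<lambda>y. V y + W y"] lie_bracket_add
      lie_bracket_commute[of V] lie_bracket_commute[of W] dirderiv_field_add
      bilinear_ladd bilinear_radd bilinear_lneg bilinear_rneg bilinear_lsub bilinear_rsub)

text \<open>The extra terms come from \<open>[a V, X] = a [V, X] - X(a) V\<close>.\<close>

lemma lie_derivative_metric_scaleR:
  assumes "bilinear (h x)" "\<And>A B. smooth_on U A \<Longrightarrow> smooth_on U B \<Longrightarrow> smooth_on U (\<lambda>y. h y (A y) (B y))"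
    "smooth_on U V" "smooth_on U a" "smooth_on U X" "smooth_on U Y"
  shows "lie_derivative_metric (\<lambda>y. a y *\<^sub>R V y) h X Y x = a x * lie_derivative_metric V h X Y x
    + dirderiv X a x * h x (V x) (Y x) + dirderiv Y a x * h x (X x) (V x)"
  using assms
  by (simp add: lie_derivative_metric_def lie_bracket_commute[of "\<lambda>y. a y *\<^sub>R V y"] lie_bracket_scaleR
      lie_bracket_commute[of V] dirderiv_field_scaleR
      bilinear_ladd bilinear_radd bilinear_lneg bilinear_rneg bilinear_lsub bilinear_rsub
      bilinear_lmul bilinear_rmul algebra_simps)

lemma lie_derivative_metric_cong:
  assumes "\<And>y. y \<in> U \<Longrightarrow> V y = V' y" "\<And>y. y \<in> U \<Longrightarrow> X y = X' y" "\<And>y. y \<in> U \<Longrightarrow> Y y = Y' y"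
  shows "lie_derivative_metric V h X Y x = lie_derivative_metric V' h X' Y' x"
proof -
  have "dirderiv V (\<lambda>y. h y (X y) (Y y)) x = dirderiv V' (\<lambda>y. h y (X' y) (Y' y)) x"
    by (rule dirderiv_cong[OF x]) (use assms x in auto)
  moreover have "lie_bracket V X x = lie_bracket V' X' x" "lie_bracket V Y x = lie_bracket V' Y' x"
    using assms by (auto intro: lie_bracket_cong)
  ultimately show ?thesis by (simp add: lie_derivative_metric_def assms x)
qed

end

end

section \<open>Connections on a coordinate domain\<close>

locale connection_domain = coordinate_domain U for U :: "(real ^ 'm::finite) set" +
  fixes G :: "real ^ 'm \<Rightarrow> real ^ 'm \<Rightarrow> real ^ 'm \<Rightarrow> real ^ 'm"
  assumes bilinear_G: "x \<in> U \<Longrightarrow> bilinear (G x)"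
    and smooth_G: "smooth_on U (\<lambda>x. G x u v)"
begin

lemma smooth_covd: "smooth_on U X \<Longrightarrow> smooth_on U Y \<Longrightarrow> smooth_on U (covd G X Y)"
  unfolding covd_def
  by (rule smooth_add[OF smooth_dirderiv smooth_apply2[where B = G, OF bilinear_G smooth_G]])

lemma smooth_curvature:
  "smooth_on U X \<Longrightarrow> smooth_on U Y \<Longrightarrow> smooth_on U Z \<Longrightarrow> smooth_on U (curvature G X Y Z)"
  unfolding curvature_def by (intro smooth_diff smooth_covd smooth_lie_bracket)

text \<open>The Lie derivative of the connection along \<open>V\<close>, that is
  \<open>(L_V \<nabla>)(X, Y)\<close>.\<close>

definition lie_connection where
  "lie_connection V X Y = (\<lambda>x. lie_bracket V (covd G X Y) x - covd G (lie_bracket V X) Y x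
    - covd G X (lie_bracket V Y) x)"

lemma smooth_lie_connection:
  "smooth_on U V \<Longrightarrow> smooth_on U X \<Longrightarrow> smooth_on U Y \<Longrightarrow> smooth_on U (lie_connection V X Y)"
  unfolding lie_connection_def by (intro smooth_diff smooth_covd smooth_lie_bracket)

context
  fixes x
  assumes x: "x \<in> U"
begin

lemmas bilinear_simps = bilinear_ladd[OF bilinear_G[OF x]] bilinear_radd[OF bilinear_G[OF x]]
  bilinear_lsub[OF bilinear_G[OF x]] bilinear_rsub[OF bilinear_G[OF x]]
  bilinear_lmul[OF bilinear_G[OF x]] bilinear_rmul[OF bilinear_G[OF x]]
  bilinear_lzero[OF bilinear_G[OF x]] bilinear_rzero[OF bilinear_G[OF x]]

lemma covd_cong:
  assumes "X x = X' x" "\<And>y. y \<in> U \<Longrightarrow> Y y = Y' y"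
  shows "covd G X Y x = covd G X' Y' x"
  using dirderiv_cong[OF x, of Y Y' X X'] assms x by (simp add: covd_def)

lemma covd_add:
  "smooth_on U Y \<Longrightarrow> smooth_on U Z \<Longrightarrow>
    covd G X (\<lambda>y. Y y + Z y) x = covd G X Y x + covd G X Z x"
  by (simp add: covd_def dirderiv_add[OF x] bilinear_simps)

lemma covd_diff:
  "smooth_on U Y \<Longrightarrow> smooth_on U Z \<Longrightarrow>
    covd G X (\<lambda>y. Y y - Z y) x = covd G X Y x - covd G X Z x"
  by (simp add: covd_def dirderiv_diff[OF x] bilinear_simps)

lemma covd_scaleR:
  "smooth_on U a \<Longrightarrow> smooth_on U Y \<Longrightarrow>
    covd G X (\<lambda>y. a y *\<^sub>R Y y) x = dirderiv X a x *\<^sub>R Y x + a x *\<^sub>R covd G X Y x"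
  by (simp add: covd_def dirderiv_scaleR[OF x] bilinear_simps algebra_simps)

lemma covd_field_add:
  "smooth_on U Z \<Longrightarrow> covd G (\<lambda>y. X y + Y y) Z x = covd G X Z x + covd G Y Z x"
  by (simp add: covd_def dirderiv_field_add[OF x] bilinear_simps)

lemma covd_field_zero:
  "smooth_on U Z \<Longrightarrow> X x = 0 \<Longrightarrow> covd G X Z x = 0"
  using linear_0[OF linear_derivative[OF x]] by (simp add: covd_def dirderiv_def bilinear_simps)

end

section \<open>Curvature: linearity, tensoriality and Lie derivative\<close>

lemma curvature_cong:
  assumes x: "x \<in> U" and "\<And>y. y \<in> U \<Longrightarrow> X y = X' y" "\<And>y. y \<in> U \<Longrightarrow> Y y = Y' y"
    "\<And>y. y \<in> U \<Longrightarrow> Z y = Z' y"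
  shows "curvature G X Y Z x = curvature G X' Y' Z' x"
proof -
  have "covd G X (covd G Y Z) x = covd G X' (covd G Y' Z') x"
    "covd G Y (covd G X Z) x = covd G Y' (covd G X' Z') x"
    using assms by (auto intro!: covd_cong)
  moreover have "covd G (lie_bracket X Y) Z x = covd G (lie_bracket X' Y') Z' x"
    using assms by (auto intro!: covd_cong lie_bracket_cong)
  ultimately show ?thesis by (simp add: curvature_def)
qed

context
  fixes x and X Y :: "real ^ 'm \<Rightarrow> real ^ 'm"
  assumes x: "x \<in> U" and X [simp]: "smooth_on U X" and Y [simp]: "smooth_on U Y"
begin

lemma covd_covd_add:
  assumes "smooth_on U A" "smooth_on U B" "smooth_on U Z" "smooth_on U Z'"
  shows "covd G A (covd G B (\<lambda>y. Z y + Z' y)) x = covd G A (covd G B Z) x + covd G A (covd G B Z') x"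
proof -
  have "covd G A (covd G B (\<lambda>y. Z y + Z' y)) x = covd G A (\<lambda>y. covd G B Z y + covd G B Z' y) x"
    by (rule covd_cong[OF x refl]) (use assms in \<open>simp add: covd_add\<close>)
  also have "\<dots> = covd G A (covd G B Z) x + covd G A (covd G B Z') x"
    using assms by (simp add: covd_add x smooth_covd)
  finally show ?thesis .
qed

lemma curvature_add:
  assumes "smooth_on U Z" "smooth_on U Z'"
  shows "curvature G X Y (\<lambda>y. Z y + Z' y) x = curvature G X Y Z x + curvature G X Y Z' x"
  by (simp add: curvature_def covd_covd_add covd_add[OF x] assms smooth_lie_bracket)

lemma covd_covd_scaleR:
  assumes "smooth_on U A" "smooth_on U B" "smooth_on U Z" "smooth_on U a"
  shows "covd G A (covd G B (\<lambda>y. a y *\<^sub>R Z y)) x = dirderiv A (dirderiv B a) x *\<^sub>R Z x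
    + dirderiv B a x *\<^sub>R covd G A Z x + dirderiv A a x *\<^sub>R covd G B Z x
    + a x *\<^sub>R covd G A (covd G B Z) x"
proof -
  have "covd G A (covd G B (\<lambda>y. a y *\<^sub>R Z y)) x
      = covd G A (\<lambda>y. dirderiv B a y *\<^sub>R Z y + a y *\<^sub>R covd G B Z y) x"
    by (rule covd_cong[OF x refl]) (use assms in \<open>simp add: covd_scaleR\<close>)
  also have "\<dots> = dirderiv A (dirderiv B a) x *\<^sub>R Z x
    + dirderiv B a x *\<^sub>R covd G A Z x + dirderiv A a x *\<^sub>R covd G B Z x
    + a x *\<^sub>R covd G A (covd G B Z) x"
    using assms by (simp add: covd_add[OF x] covd_scaleR[OF x] smooth_covd smooth_intros)
  finally show ?thesis .
qed

text \<open>The terms with one derivative of \<open>a\<close> are symmetric in \<open>X\<close> and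
  \<open>Y\<close>; those with two derivatives form a commutator, removed by the bracket term of the
  curvature.\<close>

lemma curvature_scaleR:
  assumes "smooth_on U Z" "smooth_on U a"
  shows "curvature G X Y (\<lambda>y. a y *\<^sub>R Z y) x = a x *\<^sub>R curvature G X Y Z x"
  by (simp add: curvature_def covd_covd_scaleR covd_scaleR[OF x] assms smooth_lie_bracket
      dirderiv_lie_bracket[OF x] algebra_simps)

lemma curvature_sum:
  assumes "\<And>i. i \<in> I \<Longrightarrow> smooth_on U (Z i)"
  shows "curvature G X Y (\<lambda>y. \<Sum>i\<in>I. Z i y) x = (\<Sum>i\<in>I. curvature G X Y (Z i) x)"
proof -
  have 0: "curvature G X Y (\<lambda>y. 0) x = 0"
    using curvature_scaleR[of "\<lambda>_. 0" "\<lambda>_. 0"] by (simp add: smooth_on_const)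
  show ?thesis
    using assms
    by (induction I rule: infinite_finite_induct) (auto simp: 0 curvature_add smooth_sum)
qed

lemma curvature_expansion:
  assumes "smooth_on U Z"
  shows "curvature G X Y Z x = (\<Sum>i\<in>UNIV. (Z x $ i) *\<^sub>R curvature G X Y (\<lambda>_. axis i 1) x)"
proof -
  have "curvature G X Y Z x = curvature G X Y (\<lambda>y. \<Sum>i\<in>UNIV. (Z y $ i) *\<^sub>R axis i 1) x"
    by (simp add: basis_expansion flip: scalar_mult_eq_scaleR)
  also have "\<dots> = (\<Sum>i\<in>UNIV. (Z x $ i) *\<^sub>R curvature G X Y (\<lambda>_. axis i 1) x)"
    using assms by (simp add: curvature_sum curvature_scaleR smooth_intros)
  finally show ?thesis .
qed

text \<open>The axis expansion sees \<open>Z\<close> only through \<open>Z x\<close>. This allows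
  traces over constant extensions to absorb fields such as \<open>[\<xi>, e_j]\<close>.\<close>

lemma curvature_tensorial:
  assumes "smooth_on U Z"
  shows "curvature G X Y Z x = curvature G X Y (\<lambda>_. Z x) x"
  using curvature_expansion[OF assms] curvature_expansion[OF smooth_on_const, of "Z x"] by simp

lemma linear_curvature: "linear (\<lambda>z. curvature G X Y (\<lambda>_. z) x)"
proof (rule linearI)
  show "curvature G X Y (\<lambda>_. a + b) x = curvature G X Y (\<lambda>_. a) x + curvature G X Y (\<lambda>_. b) x" for a b
    using curvature_add[of "\<lambda>_. a" "\<lambda>_. b"] by (simp add: smooth_on_const)
  show "curvature G X Y (\<lambda>_. r *\<^sub>R a) x = r *\<^sub>R curvature G X Y (\<lambda>_. a) x" for r a
    using curvature_scaleR[of "\<lambda>_. a" "\<lambda>_. r"] by (simp add: smooth_on_const)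
qed

text \<open>Moving \<open>[V, -]\<close> past a covariant derivative costs one
  \<open>lie_connection\<close> term; what remains reassembles into curvatures by the Jacobi
  identity. It is the formula for \<open>L_V R\<close> in terms of
  \<open>L_V \<nabla>\<close>.\<close>

lemma lie_bracket_curvature:
  assumes V [simp]: "smooth_on U V" and Z [simp]: "smooth_on U Z"
  shows "lie_bracket V (curvature G X Y Z) x = curvature G (lie_bracket V X) Y Z x
    + curvature G X (lie_bracket V Y) Z x + curvature G X Y (lie_bracket V Z) x
    + (covd G X (lie_connection V Y Z) x + lie_connection V X (covd G Y Z) x)
    - (covd G Y (lie_connection V X Z) x + lie_connection V Y (covd G X Z) x)
    - lie_connection V (lie_bracket X Y) Z x"
proof -
  note [simp] = smooth_covd smooth_lie_bracket smooth_lie_connection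
  have L: "lie_bracket V (covd G A B) y = lie_connection V A B y + covd G (lie_bracket V A) B y
      + covd G A (lie_bracket V B) y" for A B y
    by (simp add: lie_connection_def)
  have LL: "lie_bracket V (covd G A (covd G B Z)) x = lie_connection V A (covd G B Z) x
      + covd G (lie_bracket V A) (covd G B Z) x + covd G A (lie_connection V B Z) x
      + covd G A (covd G (lie_bracket V B) Z) x + covd G A (covd G B (lie_bracket V Z)) x"
    if [simp]: "smooth_on U A" "smooth_on U B" for A B
  proof -
    have "covd G A (lie_bracket V (covd G B Z)) x = covd G A (\<lambda>y. lie_connection V B Z y +
        covd G (lie_bracket V B) Z y + covd G B (lie_bracket V Z) y) x"
      by (rule covd_cong[OF x refl]) (rule L)
    then show ?thesis by (simp add: L covd_add[OF x] smooth_add)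
  qed
  have J: "covd G (lie_bracket V (lie_bracket X Y)) Z x =
      covd G (lie_bracket (lie_bracket V X) Y) Z x + covd G (lie_bracket X (lie_bracket V Y)) Z x"
  proof -
    have "covd G (lie_bracket V (lie_bracket X Y)) Z x =
        covd G (\<lambda>y. lie_bracket (lie_bracket V X) Y y + lie_bracket X (lie_bracket V Y) y) Z x"
      by (rule covd_cong[OF x]) (rule jacobi_identity[OF x V X Y], rule refl)
    then show ?thesis by (simp only: covd_field_add[OF x Z])
  qed
  have "lie_bracket V (curvature G X Y Z) x = lie_bracket V (covd G X (covd G Y Z)) x
      - lie_bracket V (covd G Y (covd G X Z)) x - lie_bracket V (covd G (lie_bracket X Y) Z) x"
    by (simp add: curvature_def lie_bracket_diff[OF x] smooth_diff)
  then show ?thesis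
    by (simp add: LL) (simp add: L J curvature_def algebra_simps)
qed

end

end

section \<open>Kenmotsu structures on a coordinate domain\<close>

lemma trace_matrix: "trace (matrix f) = (\<Sum>j\<in>UNIV. f (axis j 1) $ j)"
  by (simp add: trace_def matrix_def)

lemma trace_matrix_commute:
  fixes f h :: "real ^ 'm::finite \<Rightarrow> real ^ 'm"
  assumes "linear f" "linear h"
  shows "(\<Sum>j\<in>UNIV. f (h (axis j 1)) $ j) = (\<Sum>j\<in>UNIV. h (f (axis j 1)) $ j)"
  using trace_mul_sym[of "matrix f" "matrix h"]
  by (simp add: matrix_compose[OF assms, symmetric] matrix_compose[OF assms(2,1), symmetric] trace_matrix)

locale kenmotsu_domain = connection_domain U G
  for U :: "(real ^ 'm::finite) set" and G +
  fixes \<phi> :: "real ^ 'm \<Rightarrow> real ^ 'm \<Rightarrow> real ^ 'm"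
    and \<xi> :: "real ^ 'm \<Rightarrow> real ^ 'm"
    and \<eta> :: "real ^ 'm \<Rightarrow> real ^ 'm \<Rightarrow> real"
    and g :: "real ^ 'm \<Rightarrow> real ^ 'm \<Rightarrow> real ^ 'm \<Rightarrow> real"
  assumes linear_phi: "x \<in> U \<Longrightarrow> linear (\<phi> x)"
    and smooth_phi: "smooth_on U (\<lambda>x. \<phi> x u)"
    and smooth_xi: "smooth_on U \<xi>"
    and linear_eta: "x \<in> U \<Longrightarrow> linear (\<eta> x)"
    and smooth_eta: "smooth_on U (\<lambda>x. \<eta> x u)"
    and bilinear_g: "x \<in> U \<Longrightarrow> bilinear (g x)"
    and g_commute: "x \<in> U \<Longrightarrow> g x u v = g x v u"
    and g_pos: "x \<in> U \<Longrightarrow> u \<noteq> 0 \<Longrightarrow> 0 < g x u u"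
    and smooth_g: "smooth_on U (\<lambda>x. g x u v)"
    and eta_xi: "x \<in> U \<Longrightarrow> \<eta> x (\<xi> x) = 1"
    and phi_phi: "x \<in> U \<Longrightarrow> \<phi> x (\<phi> x u) = - u + \<eta> x u *\<^sub>R \<xi> x"
    and g_phi_phi: "x \<in> U \<Longrightarrow> g x (\<phi> x u) (\<phi> x v) = g x u v - \<eta> x u * \<eta> x v"
    and torsion_free: "smooth_on U X \<Longrightarrow> smooth_on U Y \<Longrightarrow> x \<in> U \<Longrightarrow>
      covd G X Y x - covd G Y X x = lie_bracket X Y x"
    and metric: "smooth_on U X \<Longrightarrow> smooth_on U Y \<Longrightarrow> smooth_on U Z \<Longrightarrow> x \<in> U \<Longrightarrow>
      dirderiv X (\<lambda>y. g y (Y y) (Z y)) x = g x (covd G X Y x) (Z x) + g x (Y x) (covd G X Z x)"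
    and covd_phi: "smooth_on U X \<Longrightarrow> smooth_on U Y \<Longrightarrow> x \<in> U \<Longrightarrow>
      covd G X (\<lambda>y. \<phi> y (Y y)) x - \<phi> x (covd G X Y x) =
        g x (\<phi> x (X x)) (Y x) *\<^sub>R \<xi> x - \<eta> x (Y x) *\<^sub>R \<phi> x (X x)"
begin

lemmas smooth_phi_apply = smooth_apply[where F = \<phi>, OF linear_phi smooth_phi]
  and smooth_eta_apply = smooth_apply[where F = \<eta>, OF linear_eta smooth_eta]
  and smooth_g_apply = smooth_apply2[where B = g, OF bilinear_g smooth_g]

text \<open>The metric of the distribution \<open>ker \<eta>\<close>, extended by zero along
  \<open>\<xi>\<close>. Unlike \<open>g\<close>, it is an eigenform of
  \<open>L_\<xi>\<close>.\<close>

definition \<gamma> where "\<gamma> x u v = g x u v - \<eta> x u * \<eta> x v"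

lemma smooth_gamma: "smooth_on U X \<Longrightarrow> smooth_on U Y \<Longrightarrow> smooth_on U (\<lambda>x. \<gamma> x (X x) (Y x))"
  unfolding \<gamma>_def by (rule smooth_diff[OF smooth_g_apply smooth_mult[OF smooth_eta_apply smooth_eta_apply]])

lemmas smooths = smooth_on_const smooth_xi smooth_phi_apply smooth_eta_apply smooth_g_apply
  smooth_gamma smooth_covd smooth_curvature smooth_lie_bracket smooth_dirderiv smooth_lie_connection

section \<open>Pointwise algebra of the almost contact metric structure\<close>

context
  fixes x
  assumes x: "x \<in> U"
begin

lemmas phi_simps = linear_0[OF linear_phi[OF x]] linear_add[OF linear_phi[OF x]]
  linear_diff[OF linear_phi[OF x]] linear_neg[OF linear_phi[OF x]] linear_cmul[OF linear_phi[OF x]]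

lemmas eta_simps = linear_0[OF linear_eta[OF x]] linear_add[OF linear_eta[OF x]]
  linear_diff[OF linear_eta[OF x]] linear_neg[OF linear_eta[OF x]] linear_cmul[OF linear_eta[OF x]]
  eta_xi[OF x]

lemmas g_simps = bilinear_ladd[OF bilinear_g[OF x]] bilinear_radd[OF bilinear_g[OF x]]
  bilinear_lsub[OF bilinear_g[OF x]] bilinear_rsub[OF bilinear_g[OF x]]
  bilinear_lmul[OF bilinear_g[OF x]] bilinear_rmul[OF bilinear_g[OF x]]
  bilinear_lneg[OF bilinear_g[OF x]] bilinear_rneg[OF bilinear_g[OF x]]
  bilinear_lzero[OF bilinear_g[OF x]] bilinear_rzero[OF bilinear_g[OF x]]

lemma xi_nonzero: "\<xi> x \<noteq> 0"
  using eta_xi[OF x] eta_simps(1) by auto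

text \<open>From \<open>\<phi>^2 \<xi> = 0\<close> the formula for \<open>\<phi>^2\<close> at
  \<open>\<phi> \<xi>\<close> makes \<open>\<phi> \<xi>\<close> a multiple of \<open>\<xi>\<close>.
  Applying \<open>\<phi>\<close> once more, the coefficient or \<open>\<phi> \<xi>\<close> itself
  vanishes, and either way \<open>\<phi> \<xi> = 0\<close>.\<close>

lemma phi_xi: "\<phi> x (\<xi> x) = 0"
proof -
  have 0: "\<phi> x (\<phi> x (\<xi> x)) = 0" by (simp add: phi_phi[OF x] eta_simps)
  then have 1: "\<phi> x (\<xi> x) = \<eta> x (\<phi> x (\<xi> x)) *\<^sub>R \<xi> x"
    using phi_phi[OF x, of "\<phi> x (\<xi> x)"] by (simp add: phi_simps)
  have "\<eta> x (\<phi> x (\<xi> x)) *\<^sub>R \<phi> x (\<xi> x) = 0"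
    using arg_cong[OF 1, of "\<phi> x"] 0 by (simp add: phi_simps)
  then show ?thesis using 1 by (metis scaleR_eq_0_iff scaleR_zero_left)
qed

text \<open>Compares the two ways of evaluating \<open>\<phi>^3 u\<close> from the formula for
  \<open>\<phi>^2\<close>.\<close>

lemma eta_phi: "\<eta> x (\<phi> x u) = 0"
proof -
  have "\<phi> x (\<phi> x (\<phi> x u)) = - \<phi> x u"
    using arg_cong[OF phi_phi[OF x, of u], of "\<phi> x"] by (simp add: phi_simps phi_xi)
  then have "\<eta> x (\<phi> x u) *\<^sub>R \<xi> x = 0"
    using phi_phi[OF x, of "\<phi> x u"] by simp
  then show ?thesis using xi_nonzero by simp
qed

lemma g_xi: "g x u (\<xi> x) = \<eta> x u" "g x (\<xi> x) u = \<eta> x u"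
  using g_phi_phi[OF x, of u "\<xi> x"] g_commute[OF x]
  by (simp_all add: phi_xi g_simps eta_simps)

lemma bilinear_gamma: "bilinear (\<gamma> x)"
  unfolding bilinear_def
  by (intro conjI allI linearI) (simp_all add: \<gamma>_def g_simps eta_simps algebra_simps)

lemma gamma_commute: "\<gamma> x u v = \<gamma> x v u"
  by (simp add: \<gamma>_def g_commute[OF x])

lemma gamma_xi: "\<gamma> x u (\<xi> x) = 0" "\<gamma> x (\<xi> x) u = 0"
  by (simp_all add: \<gamma>_def g_xi eta_simps)

section \<open>Covariant derivatives of the structure tensors\<close>

text \<open>\<open>\<xi>\<close> has constant length, so its covariant derivatives are orthogonal to
  it.\<close>

lemma eta_covd_xi:
  assumes "smooth_on U X"
  shows "\<eta> x (covd G X \<xi> x) = 0"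
proof -
  have "dirderiv X (\<lambda>y. g y (\<xi> y) (\<xi> y)) x = dirderiv X (\<lambda>y. 1) x"
    by (rule dirderiv_cong[OF x]) (simp_all add: kenmotsu_domain.g_xi[OF kenmotsu_domain_axioms] eta_xi)
  then show ?thesis using metric[OF assms smooth_xi smooth_xi x] by (simp add: g_xi)
qed

lemma covd_zero: "covd G X (\<lambda>y. 0) x = 0"
  by (simp add: covd_def bilinear_simps[OF x])

end

text \<open>Differentiating \<open>\<phi> \<xi> = 0\<close> with the Kenmotsu identity leaves
  \<open>\<phi> (\<nabla>_X \<xi>) = \<phi> X\<close>. A second \<open>\<phi>\<close> recovers
  \<open>\<nabla>_X \<xi>\<close> up to its \<open>\<xi>\<close> component, which is zero by
  \<open>eta_covd_xi\<close>.\<close>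

lemma covd_xi:
  assumes x: "x \<in> U" and X: "smooth_on U X"
  shows "covd G X \<xi> x = X x - \<eta> x (X x) *\<^sub>R \<xi> x"
proof -
  have "covd G X (\<lambda>y. \<phi> y (\<xi> y)) x = covd G X (\<lambda>y. 0) x"
    by (rule covd_cong[OF x refl]) (simp add: phi_xi)
  then have "\<phi> x (covd G X \<xi> x) = \<phi> x (X x)"
    using covd_phi[OF X smooth_xi x] x by (simp add: covd_zero g_xi eta_phi eta_xi)
  then have "\<phi> x (\<phi> x (covd G X \<xi> x)) = \<phi> x (\<phi> x (X x))" by simp
  then have "- covd G X \<xi> x = - X x + \<eta> x (X x) *\<^sub>R \<xi> x"
    using x X by (simp add: phi_phi eta_covd_xi)
  from arg_cong[OF this, of uminus] show ?thesis by simp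
qed

text \<open>In tensor form \<open>(\<nabla>_X \<eta>)(Y) = \<gamma>(X, Y)\<close>:
  \<open>\<eta>\<close> is the metric dual of \<open>\<xi>\<close>, and \<open>covd_xi\<close> gives
  the derivative of \<open>\<xi>\<close>.\<close>

lemma dirderiv_eta:
  assumes x: "x \<in> U" and X: "smooth_on U X" and Y: "smooth_on U Y"
  shows "dirderiv X (\<lambda>y. \<eta> y (Y y)) x = \<eta> x (covd G X Y x) + \<gamma> x (X x) (Y x)"
proof -
  have "dirderiv X (\<lambda>y. \<eta> y (Y y)) x = dirderiv X (\<lambda>y. g y (Y y) (\<xi> y)) x"
    by (rule dirderiv_cong[OF x _ refl]) (simp add: g_xi)
  then show ?thesis
    using x by (simp add: metric X Y smooth_xi covd_xi g_xi g_simps gamma_commute[OF x, of "X x"])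
      (simp add: \<gamma>_def)
qed

text \<open>Equivalent to \<open>L_\<xi> \<eta> = 0\<close>.\<close>

lemma eta_lie_bracket_xi:
  assumes x: "x \<in> U" and X: "smooth_on U X"
  shows "\<eta> x (lie_bracket \<xi> X x) = dirderiv \<xi> (\<lambda>y. \<eta> y (X y)) x"
  using x X by (simp add: dirderiv_eta smooth_xi gamma_xi eta_covd_xi eta_simps flip: torsion_free)

lemma dirderiv_gamma:
  assumes x: "x \<in> U" and [simp]: "smooth_on U X" "smooth_on U Y" "smooth_on U Z"
  shows "dirderiv X (\<lambda>y. \<gamma> y (Y y) (Z y)) x = \<gamma> x (covd G X Y x) (Z x) + \<gamma> x (Y x) (covd G X Z x)
    - \<gamma> x (X x) (Y x) * \<eta> x (Z x) - \<eta> x (Y x) * \<gamma> x (X x) (Z x)"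
proof -
  have "dirderiv X (\<lambda>y. \<gamma> y (Y y) (Z y)) x = dirderiv X (\<lambda>y. g y (Y y) (Z y)) x
    - (\<eta> x (Y x) * dirderiv X (\<lambda>y. \<eta> y (Z y)) x + dirderiv X (\<lambda>y. \<eta> y (Y y)) x * \<eta> x (Z x))"
    unfolding \<gamma>_def
    by (simp add: dirderiv_diff[OF x] dirderiv_mult[OF x] smooth_g_apply smooth_eta_apply smooth_mult)
  then show ?thesis
    by (simp add: dirderiv_eta[OF x] metric x) (simp add: \<gamma>_def algebra_simps)
qed

section \<open>Lie derivatives along the Reeb field\<close>

text \<open>Equivalent to \<open>L_\<xi> g = 2 \<gamma>\<close>; torsion-freeness exchanges brackets
  for covariant derivatives, and \<open>covd_xi\<close> supplies the term
  \<open>2 \<gamma>\<close>.\<close>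

lemma dirderiv_xi_g:
  assumes x: "x \<in> U" and "smooth_on U X" "smooth_on U Y"
  shows "dirderiv \<xi> (\<lambda>y. g y (X y) (Y y)) x =
    2 * \<gamma> x (X x) (Y x) + g x (lie_bracket \<xi> X x) (Y x) + g x (X x) (lie_bracket \<xi> Y x)"
  using assms
  by (simp add: metric smooth_xi covd_xi g_simps g_xi flip: torsion_free) (simp add: \<gamma>_def)

lemma dirderiv_xi_gamma:
  assumes x: "x \<in> U" and "smooth_on U X" "smooth_on U Y"
  shows "dirderiv \<xi> (\<lambda>y. \<gamma> y (X y) (Y y)) x =
    2 * \<gamma> x (X x) (Y x) + \<gamma> x (lie_bracket \<xi> X x) (Y x) + \<gamma> x (X x) (lie_bracket \<xi> Y x)"
  using assms bilinear_gamma[OF x]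
  by (simp add: dirderiv_gamma smooth_xi covd_xi gamma_xi bilinear_lsub bilinear_rsub
      bilinear_lmul bilinear_rmul flip: torsion_free)

lemma lie_derivative_gamma:
  assumes "x \<in> U" "smooth_on U X" "smooth_on U Y"
  shows "lie_derivative_metric \<xi> \<gamma> X Y x = 2 * \<gamma> x (X x) (Y x)"
  using assms by (simp add: lie_derivative_metric_def dirderiv_xi_gamma)

text \<open>\<open>\<phi>\<close> is parallel along \<open>\<xi>\<close> because
  \<open>\<phi> \<xi> = 0\<close>, and by \<open>covd_xi\<close> it commutes with
  \<open>X \<mapsto> \<nabla>_X \<xi>\<close>.\<close>

lemma lie_bracket_phi:
  assumes x: "x \<in> U" and X: "smooth_on U X"
  shows "lie_bracket \<xi> (\<lambda>y. \<phi> y (X y)) x = \<phi> x (lie_bracket \<xi> X x)"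
proof -
  have "covd G \<xi> (\<lambda>y. \<phi> y (X y)) x = \<phi> x (covd G \<xi> X x)"
    using covd_phi[OF smooth_xi X x] x by (simp add: phi_xi g_simps)
  then show ?thesis
    using x X by (simp add: smooth_xi smooth_phi_apply covd_xi eta_phi phi_simps phi_xi flip: torsion_free)
qed

text \<open>The argument is that for uniqueness of the Levi-Civita connection: \<open>T\<close> is
  the defect of the claim, lowered by the metric, and the two defining properties of
  \<open>\<nabla>\<close> give it incompatible symmetries.\<close>

lemma lie_connection_xi:
  assumes x: "x \<in> U" and X: "smooth_on U X" and Y: "smooth_on U Y"
  shows "lie_connection \<xi> X Y x = - (2 * \<gamma> x (X x) (Y x)) *\<^sub>R \<xi> x"
proof -
  note [simp] = smooth_xi smooth_covd smooth_lie_bracket smooth_lie_connection smooth_g_apply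
    smooth_gamma smooth_dirderiv
  define T where "T A B C = g x (lie_connection \<xi> A B x) (C x) + 2 * \<gamma> x (A x) (B x) * \<eta> x (C x)"
    for A B C
  \<comment> \<open>The bracket with \<open>\<xi>\<close> is applied to the torsion-free identity;
    the Jacobi identity does the rest.\<close>
  have sym: "T A B C = T B A C" if [simp]: "smooth_on U A" "smooth_on U B" for A B C
  proof -
    have "lie_bracket \<xi> (covd G A B) x - lie_bracket \<xi> (covd G B A) x
        = lie_bracket \<xi> (\<lambda>y. covd G A B y - covd G B A y) x"
      by (simp add: lie_bracket_diff[OF x])
    also have "\<dots> = lie_bracket \<xi> (lie_bracket A B) x"
      by (rule lie_bracket_cong[OF x]) (simp_all add: torsion_free)
    also have "\<dots> = lie_bracket (lie_bracket \<xi> A) B x + lie_bracket A (lie_bracket \<xi> B) x"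
      by (rule jacobi_identity[OF x smooth_xi that])
    finally have "lie_connection \<xi> A B x = lie_connection \<xi> B A x"
      by (simp add: lie_connection_def x algebra_simps flip: torsion_free)
    then show ?thesis by (simp add: T_def gamma_commute[OF x, of "A x"])
  qed
  \<comment> \<open>Applying \<open>L_\<xi>\<close> to \<open>\<nabla> g = 0\<close> shows that the
    \<open>lie_connection\<close> terms add up to \<open>2 (\<nabla>_A \<gamma>)(B, C)\<close>,
    which \<open>dirderiv_gamma\<close> evaluates; the correction in \<open>T\<close> cancels it
    exactly.\<close>
  have skew: "T A B C = - T A C B" if [simp]: "smooth_on U A" "smooth_on U B" "smooth_on U C" for A B C
  proof -
    have "dirderiv \<xi> (dirderiv A (\<lambda>y. g y (B y) (C y))) x
        = dirderiv \<xi> (\<lambda>y. g y (covd G A B y) (C y) + g y (B y) (covd G A C y)) x"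
      by (rule dirderiv_cong[OF x _ refl]) (simp add: metric)
    also have "\<dots> = dirderiv \<xi> (\<lambda>y. g y (covd G A B y) (C y)) x + dirderiv \<xi> (\<lambda>y. g y (B y) (covd G A C y)) x"
      by (simp add: dirderiv_add[OF x])
    finally have 1: "dirderiv \<xi> (dirderiv A (\<lambda>y. g y (B y) (C y))) x = \<dots>" .
    have "dirderiv A (dirderiv \<xi> (\<lambda>y. g y (B y) (C y))) x = dirderiv A (\<lambda>y. 2 * \<gamma> y (B y) (C y)
        + g y (lie_bracket \<xi> B y) (C y) + g y (B y) (lie_bracket \<xi> C y)) x"
      by (rule dirderiv_cong[OF x _ refl]) (simp add: dirderiv_xi_g)
    also have "\<dots> = 2 * dirderiv A (\<lambda>y. \<gamma> y (B y) (C y)) x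
        + dirderiv A (\<lambda>y. g y (lie_bracket \<xi> B y) (C y)) x + dirderiv A (\<lambda>y. g y (B y) (lie_bracket \<xi> C y)) x"
      by (simp add: dirderiv_add[OF x] dirderiv_mult[OF x] smooth_add smooth_mult smooth_on_const)
    finally have 2: "dirderiv A (dirderiv \<xi> (\<lambda>y. g y (B y) (C y))) x = \<dots>" .
    have "dirderiv (lie_bracket \<xi> A) (\<lambda>y. g y (B y) (C y)) x =
        dirderiv \<xi> (dirderiv A (\<lambda>y. g y (B y) (C y))) x - dirderiv A (dirderiv \<xi> (\<lambda>y. g y (B y) (C y))) x"
      by (simp add: dirderiv_lie_bracket[OF x])
    then show ?thesis
      unfolding T_def lie_connection_def 1 2
      by (simp add: dirderiv_xi_g[OF x] metric[where X = A, OF _ _ _ x]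
          metric[where X = "lie_bracket \<xi> A", OF _ _ _ x] dirderiv_gamma[OF x] g_simps[OF x]
          g_commute[OF x, of "B x"] gamma_commute[OF x] algebra_simps)
  qed
  \<comment> \<open>symmetric in the first two and skew in the last two arguments, hence zero\<close>
  have T0: "T X Y C = 0" if C: "smooth_on U C" for C
    using sym[OF X Y, of C] sym[OF C X, of Y] sym[OF Y C, of X]
      skew[OF X Y C] skew[OF Y C X] skew[OF C X Y] by linarith
  \<comment> \<open>The defect vector is tested against its own constant extension, so positivity of
    \<open>g\<close> makes it vanish.\<close>
  define w where "w = lie_connection \<xi> X Y x + (2 * \<gamma> x (X x) (Y x)) *\<^sub>R \<xi> x"
  have "g x w w = T X Y (\<lambda>_. w)"
    by (simp add: T_def w_def g_simps[OF x] g_xi[OF x])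
  then have "w = 0"
    using T0[OF smooth_on_const] g_pos[OF x, of w] by (metis less_irrefl)
  then show ?thesis by (simp add: w_def add_eq_0_iff2)
qed

text \<open>The \<open>lie_connection\<close> terms are multiples of \<open>\<xi>\<close> and die
  under \<open>\<phi>\<close>. Their covariant derivatives survive only through
  \<open>\<nabla>_A \<xi>\<close>, whose image under \<open>\<phi>\<close> is
  \<open>\<phi> A\<close>.\<close>

lemma phi_lie_bracket_curvature:
  assumes x: "x \<in> U" and X [simp]: "smooth_on U X" and Y [simp]: "smooth_on U Y"
    and Z [simp]: "smooth_on U Z"
  shows "\<phi> x (lie_bracket \<xi> (curvature G X Y Z) x) = \<phi> x (curvature G (lie_bracket \<xi> X) Y Z x)
    + \<phi> x (curvature G X (lie_bracket \<xi> Y) Z x) + \<phi> x (curvature G X Y (lie_bracket \<xi> Z) x)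
    - (2 * \<gamma> x (Y x) (Z x)) *\<^sub>R \<phi> x (X x) + (2 * \<gamma> x (X x) (Z x)) *\<^sub>R \<phi> x (Y x)"
proof -
  note [simp] = smooths phi_simps[OF x] phi_xi[OF x]
  have L: "\<phi> x (lie_connection \<xi> A B x) = 0" if "smooth_on U A" "smooth_on U B" for A B
    using that by (simp add: lie_connection_xi[OF x])
  have D: "\<phi> x (covd G A (lie_connection \<xi> B Z) x) = - (2 * \<gamma> x (B x) (Z x)) *\<^sub>R \<phi> x (A x)"
    if [simp]: "smooth_on U A" "smooth_on U B" for A B
  proof -
    have s: "smooth_on U (\<lambda>y. - (2 * \<gamma> y (B y) (Z y)))"
      by (intro smooth_minus smooth_mult smooth_on_const smooth_gamma that Z)
    have "covd G A (lie_connection \<xi> B Z) x = covd G A (\<lambda>y. - (2 * \<gamma> y (B y) (Z y)) *\<^sub>R \<xi> y) x"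
      by (rule covd_cong[OF x refl], rule lie_connection_xi) auto
    also have "\<dots> = dirderiv A (\<lambda>y. - (2 * \<gamma> y (B y) (Z y))) x *\<^sub>R \<xi> x
        + - (2 * \<gamma> x (B x) (Z x)) *\<^sub>R (A x - \<eta> x (A x) *\<^sub>R \<xi> x)"
      by (simp only: covd_scaleR[OF x s smooth_xi] covd_xi[OF x that(1)])
    finally show ?thesis by simp
  qed
  show ?thesis
    by (subst lie_bracket_curvature[OF x X Y smooth_xi Z]) (simp add: L D)
qed

section \<open>The *-Ricci tensor along the Reeb field\<close>

lemma smooth_star_ricci:
  assumes "smooth_on U X" "smooth_on U Y"
  shows "smooth_on U (star_ricci G \<phi> X Y)"
  unfolding star_ricci_def trace_matrix
  by (intro smooth_mult smooth_sum smooth_component smooth_phi_apply smooth_curvature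
      smooth_on_const assms)

text \<open>This is \<open>L_\<xi> Ric* = - 2 \<gamma>\<close>. As \<open>\<phi>\<close> is
  invariant along \<open>\<xi>\<close>, only the change of the curvature contributes to the
  trace.\<close>

lemma dirderiv_star_ricci:
  assumes x: "x \<in> U" and X [simp]: "smooth_on U X" and Y [simp]: "smooth_on U Y"
  shows "dirderiv \<xi> (star_ricci G \<phi> X Y) x = star_ricci G \<phi> (lie_bracket \<xi> X) Y x
    + star_ricci G \<phi> X (lie_bracket \<xi> Y) x - 2 * \<gamma> x (X x) (Y x)"
proof -
  note [simp] = smooths
  let ?Y = "\<lambda>y. \<phi> y (Y y)"
  define R where "R j = curvature G X ?Y (\<lambda>_. axis j 1)" for j
  define T where "T j = (\<lambda>y. \<phi> y (R j y))" for j
  define E where "E z = \<phi> x (curvature G X ?Y (\<lambda>_. z) x)" for z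
  \<comment> \<open>The Jacobian of \<open>\<xi>\<close> measures how far the coordinate frame is
    from being invariant: \<open>[\<xi>, e_j] = - D e_j\<close>.\<close>
  define D where "D = frechet_derivative \<xi> (at x)"
  have [simp]: "smooth_on U (R j)" "smooth_on U (T j)" for j by (simp_all add: R_def T_def)
  have D: "linear D" unfolding D_def by (rule linear_derivative[OF x smooth_xi])
  have E: "linear E"
    unfolding E_def using linear_compose[OF linear_curvature[OF x X] linear_phi[OF x], of ?Y]
    by (simp add: o_def)
  have "dirderiv \<xi> (star_ricci G \<phi> X Y) x = dirderiv \<xi> (\<lambda>y. 1 / 2 * (\<Sum>j\<in>UNIV. T j y $ j)) x"
    by (simp add: star_ricci_def trace_matrix T_def R_def)
  also have "\<dots> = 1 / 2 * (\<Sum>j\<in>UNIV. dirderiv \<xi> (T j) x $ j)"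
    by (subst dirderiv_mult[OF x smooth_on_const])
      (simp_all add: dirderiv_sum[OF x] smooth_sum smooth_component
        dirderiv_bounded_linear[OF x bounded_linear_vec_nth])
  finally have S: "dirderiv \<xi> (star_ricci G \<phi> X Y) x = 1 / 2 * (\<Sum>j\<in>UNIV. dirderiv \<xi> (T j) x $ j)" .
  \<comment> \<open>\<open>D\<close> enters twice: in passing from the componentwise derivative of
    \<open>T j\<close> to its bracket with \<open>\<xi>\<close>, and through the bracket of
    \<open>\<xi>\<close> with the frame vector in the last curvature slot.\<close>
  have dT: "dirderiv \<xi> (T j) x = \<phi> x (curvature G (lie_bracket \<xi> X) ?Y (\<lambda>_. axis j 1) x)
      + \<phi> x (curvature G X (\<lambda>y. \<phi> y (lie_bracket \<xi> Y y)) (\<lambda>_. axis j 1) x)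
      - E (D (axis j 1)) + D (E (axis j 1))
      - (2 * \<gamma> x (?Y x) (axis j 1)) *\<^sub>R \<phi> x (X x) + (2 * \<gamma> x (X x) (axis j 1)) *\<^sub>R \<phi> x (?Y x)" for j
  proof -
    have "dirderiv \<xi> (T j) x = lie_bracket \<xi> (T j) x + D (E (axis j 1))"
      by (simp add: lie_bracket_def D_def dirderiv_def T_def R_def E_def)
    also have "lie_bracket \<xi> (T j) x = \<phi> x (lie_bracket \<xi> (R j) x)"
      unfolding T_def by (rule lie_bracket_phi[OF x]) simp
    also have "\<dots> = \<phi> x (curvature G (lie_bracket \<xi> X) ?Y (\<lambda>_. axis j 1) x)
      + \<phi> x (curvature G X (lie_bracket \<xi> ?Y) (\<lambda>_. axis j 1) x)
      + \<phi> x (curvature G X ?Y (lie_bracket \<xi> (\<lambda>_. axis j 1)) x)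
      - (2 * \<gamma> x (?Y x) (axis j 1)) *\<^sub>R \<phi> x (X x) + (2 * \<gamma> x (X x) (axis j 1)) *\<^sub>R \<phi> x (?Y x)"
      unfolding R_def by (rule phi_lie_bracket_curvature[OF x]) simp_all
    also have "curvature G X (lie_bracket \<xi> ?Y) (\<lambda>_. axis j 1) x
        = curvature G X (\<lambda>y. \<phi> y (lie_bracket \<xi> Y y)) (\<lambda>_. axis j 1) x"
      by (rule curvature_cong[OF x]) (simp_all add: lie_bracket_phi)
    also have "\<phi> x (curvature G X ?Y (lie_bracket \<xi> (\<lambda>_. axis j 1)) x) = E (lie_bracket \<xi> (\<lambda>_. axis j 1) x)"
      unfolding E_def by (subst curvature_tensorial[OF x]) simp_all
    also have "lie_bracket \<xi> (\<lambda>_. axis j 1) x = - D (axis j 1)"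
      by (simp add: lie_bracket_def D_def) (simp add: dirderiv_def)
    finally show ?thesis by (simp add: linear_neg[OF E])
  qed
  \<comment> \<open>The trace of the rank-one map \<open>z \<mapsto> u z *\<^sub>R w\<close> is
    \<open>u w\<close>; the last two terms of \<open>dT\<close> are of this kind.\<close>
  have "(\<Sum>j\<in>UNIV. u (axis j 1) * w $ j) = u w" if "linear u" for u :: "real ^ 'm \<Rightarrow> real" and w
    using linear_axis_expansion[OF that, of w] by (simp add: mult.commute)
  then have K: "(\<Sum>j\<in>UNIV. 2 * \<gamma> x a (axis j 1) * w $ j) = 2 * \<gamma> x a w" for a w
    using bilinear_gamma[OF x] by (simp add: bilinear_def mult.assoc flip: sum_distrib_left)
  \<comment> \<open>Each rank-one trace contributes \<open>- 2 \<gamma>(X, Y)\<close>; the factor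
    1/2 in \<open>star_ricci\<close> turns the total \<open>- 4\<close> into
    \<open>- 2\<close>.\<close>
  have 1: "\<gamma> x (?Y x) (\<phi> x (X x)) = \<gamma> x (X x) (Y x)"
    by (simp add: \<gamma>_def g_phi_phi eta_phi x g_commute[OF x, of "Y x"])
  have 2: "\<gamma> x (X x) (\<phi> x (?Y x)) = - \<gamma> x (X x) (Y x)"
    using bilinear_gamma[OF x]
    by (simp add: phi_phi[OF x] bilinear_radd bilinear_rsub bilinear_rneg bilinear_rmul gamma_xi[OF x])
  have "(\<Sum>j\<in>UNIV. dirderiv \<xi> (T j) x $ j) =
      (\<Sum>j\<in>UNIV. \<phi> x (curvature G (lie_bracket \<xi> X) ?Y (\<lambda>_. axis j 1) x) $ j)
      + (\<Sum>j\<in>UNIV. \<phi> x (curvature G X (\<lambda>y. \<phi> y (lie_bracket \<xi> Y y)) (\<lambda>_. axis j 1) x) $ j)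
      - (\<Sum>j\<in>UNIV. E (D (axis j 1)) $ j) + (\<Sum>j\<in>UNIV. D (E (axis j 1)) $ j)
      - (\<Sum>j\<in>UNIV. 2 * \<gamma> x (?Y x) (axis j 1) * \<phi> x (X x) $ j)
      + (\<Sum>j\<in>UNIV. 2 * \<gamma> x (X x) (axis j 1) * \<phi> x (?Y x) $ j)"
    by (simp only: dT sum.distrib sum_subtractf vector_add_component vector_minus_component
        vector_scaleR_component real_scaleR_def)
  \<comment> \<open>The terms with \<open>D\<close> form the trace of a commutator of
    \<open>D\<close> and \<open>E\<close>, hence vanish.\<close>
  then show ?thesis
    unfolding S K 1 2 trace_matrix_commute[OF E D]
    by (simp add: star_ricci_def trace_matrix)
qed

text \<open>The commutator rule for \<open>L_\<xi>\<close> and \<open>L_V\<close> on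
  \<open>\<gamma>\<close>; since \<open>L_\<xi> \<gamma> = 2 \<gamma>\<close>, the term
  \<open>L_V L_\<xi> \<gamma>\<close> is just \<open>2 L_V \<gamma>\<close>.\<close>

lemma lie_derivative_gamma_commutator:
  assumes x: "x \<in> U" and V [simp]: "smooth_on U V" and X [simp]: "smooth_on U X"
    and Y [simp]: "smooth_on U Y"
  shows "lie_derivative_metric (lie_bracket \<xi> V) \<gamma> X Y x =
    dirderiv \<xi> (lie_derivative_metric V \<gamma> X Y) x
      - lie_derivative_metric V \<gamma> (lie_bracket \<xi> X) Y x
      - lie_derivative_metric V \<gamma> X (lie_bracket \<xi> Y) x
      - 2 * lie_derivative_metric V \<gamma> X Y x"
proof -
  note [simp] = smooths
  have "dirderiv V (lie_derivative_metric \<xi> \<gamma> X Y) x = dirderiv V (\<lambda>y. 2 * \<gamma> y (X y) (Y y)) x"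
    by (rule dirderiv_cong[OF x _ refl]) (simp add: lie_derivative_gamma)
  also have "\<dots> = 2 * dirderiv V (\<lambda>y. \<gamma> y (X y) (Y y)) x"
    by (simp add: dirderiv_mult[OF x])
  finally have "dirderiv V (lie_derivative_metric \<xi> \<gamma> X Y) x
      - lie_derivative_metric \<xi> \<gamma> (lie_bracket V X) Y x
      - lie_derivative_metric \<xi> \<gamma> X (lie_bracket V Y) x = 2 * lie_derivative_metric V \<gamma> X Y x"
    by (simp add: lie_derivative_gamma[OF x]) (simp add: lie_derivative_metric_def)
  moreover have "smooth_on U (\<lambda>y. \<gamma> y u v)" for u v
    by (rule smooth_gamma[OF smooth_on_const smooth_on_const])
  ultimately show ?thesis
    using lie_derivative_metric_commutator[of x \<gamma> \<xi> V X Y] x bilinear_gamma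
    by simp
qed

end

section \<open>Solitons\<close>

locale star_ricci_soliton_domain = kenmotsu_domain U G \<phi> \<xi> \<eta> g
  for U :: "(real ^ 'm::finite) set" and G \<phi> \<xi> \<eta> g +
  fixes V :: "real ^ 'm \<Rightarrow> real ^ 'm" and \<Lambda> :: "real ^ 'm \<Rightarrow> real"
  assumes smooth_V: "smooth_on U V"
    and smooth_Lambda: "smooth_on U \<Lambda>"
    and soliton: "smooth_on U X \<Longrightarrow> smooth_on U Y \<Longrightarrow> x \<in> U \<Longrightarrow>
      1 / 2 * lie_derivative_metric V g X Y x + star_ricci G \<phi> X Y x = \<Lambda> x * g x (X x) (Y x)"
    and jacobi_xi: "x \<in> U \<Longrightarrow> covd G \<xi> (covd G \<xi> V) x + curvature G V \<xi> \<xi> x = 0"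
begin

section \<open>The bracket of the Reeb field with the potential field\<close>

abbreviation W where "W \<equiv> lie_bracket \<xi> V"

text \<open>\<open>\<phi> \<xi> = 0\<close> puts the zero field into the second slot of the
  curvature.\<close>

lemma star_ricci_xi:
  assumes x: "x \<in> U" and X: "smooth_on U X"
  shows "star_ricci G \<phi> X \<xi> x = 0"
proof -
  have "curvature G X (\<lambda>y. \<phi> y (\<xi> y)) (\<lambda>_. z) x = 0" for z
  proof -
    have "curvature G X (\<lambda>y. \<phi> y (\<xi> y)) (\<lambda>_. z) x = curvature G X (\<lambda>_. 0) (\<lambda>_. z) x"
      by (rule curvature_cong[OF x]) (simp_all add: phi_xi)
    moreover have "covd G X (covd G (\<lambda>_. 0) (\<lambda>_. z)) x = covd G X (\<lambda>_. 0) x"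
      by (rule covd_cong[OF x refl]) (simp add: covd_field_zero smooth_on_const)
    moreover have "lie_bracket X (\<lambda>_. 0) x = 0"
      using linear_0[OF linear_derivative[OF x X]] by (simp add: lie_bracket_def) (simp add: dirderiv_def)
    ultimately show ?thesis
      by (simp add: curvature_def covd_zero[OF x] covd_field_zero[OF x] smooth_on_const smooth_covd X)
  qed
  then show ?thesis by (simp add: star_ricci_def trace_matrix phi_simps[OF x])
qed

lemma eta_W:
  assumes x: "x \<in> U"
  shows "\<eta> x (W x) = \<Lambda> x"
proof -
  have "dirderiv V (\<lambda>y. g y (\<xi> y) (\<xi> y)) x = dirderiv V (\<lambda>y. 1) x"
    by (rule dirderiv_cong[OF x _ refl]) (simp add: g_xi eta_xi)
  \<comment> \<open>As \<open>g(\<xi>, \<xi>)\<close> is constant, only the two bracket terms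
    remain; \<open>[V, \<xi>] = - W\<close> fixes the sign.\<close>
  then have "lie_derivative_metric V g \<xi> \<xi> x = 2 * \<eta> x (W x)"
    by (simp add: lie_derivative_metric_def lie_bracket_commute[OF x, of V] g_xi[OF x] eta_simps[OF x])
  then show ?thesis
    using soliton[OF smooth_xi smooth_xi x] by (simp add: star_ricci_xi x smooth_xi g_xi eta_xi)
qed

text \<open>Since \<open>\<nabla>_\<xi> \<xi> = 0\<close> and
  \<open>W = \<nabla>_\<xi> V - \<nabla>_V \<xi>\<close>, the Jacobi equation collapses to
  \<open>\<nabla>_\<xi> W + \<nabla>_W \<xi> = 0\<close>. Hence
  \<open>[\<xi>, W] = - 2 \<nabla>_W \<xi>\<close>, and \<open>covd_xi\<close> applies.\<close>

lemma lie_bracket_xi_W: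
  assumes x: "x \<in> U"
  shows "lie_bracket \<xi> W x = (2 * \<Lambda> x) *\<^sub>R \<xi> x + (-2) *\<^sub>R W x"
proof -
  note [simp] = smooths smooth_V
  have xi_xi: "covd G \<xi> \<xi> y = 0" if "y \<in> U" for y
    using that by (simp add: covd_xi eta_xi)
  have "covd G V (covd G \<xi> \<xi>) x = covd G V (\<lambda>y. 0) x"
    by (rule covd_cong[OF x refl xi_xi])
  then have 1: "covd G V (covd G \<xi> \<xi>) x = 0" by (simp add: covd_zero[OF x])
  have "covd G \<xi> W x = covd G \<xi> (\<lambda>y. covd G \<xi> V y - covd G V \<xi> y) x"
    by (rule covd_cong[OF x refl]) (simp add: torsion_free)
  then have 2: "covd G \<xi> W x = covd G \<xi> (covd G \<xi> V) x - covd G \<xi> (covd G V \<xi>) x"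
    by (simp add: covd_diff[OF x])
  have "covd G (lie_bracket V \<xi>) \<xi> x = - covd G W \<xi> x"
    by (simp add: covd_xi[OF x] lie_bracket_commute[OF x, of V] eta_simps[OF x])
  then have "covd G \<xi> W x + covd G W \<xi> x = 0"
    using jacobi_xi[OF x] by (simp add: curvature_def 1 2 algebra_simps)
  then have "lie_bracket \<xi> W x = (-2) *\<^sub>R covd G W \<xi> x"
    by (simp add: x add_eq_0_iff2 scaleR_2 flip: torsion_free)
  then show ?thesis by (simp add: covd_xi[OF x] eta_W[OF x] algebra_simps)
qed

lemma dirderiv_xi_Lambda:
  assumes x: "x \<in> U"
  shows "dirderiv \<xi> \<Lambda> x = 0"
proof -
  have "dirderiv \<xi> \<Lambda> x = dirderiv \<xi> (\<lambda>y. \<eta> y (W y)) x"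
    by (rule dirderiv_cong[OF x _ refl]) (simp add: eta_W)
  also have "\<dots> = \<eta> x (lie_bracket \<xi> W x)"
    by (simp add: eta_lie_bracket_xi x smooth_lie_bracket smooth_xi smooth_V)
  also have "\<dots> = 0"
    by (simp add: lie_bracket_xi_W[OF x] eta_simps[OF x] eta_W[OF x])
  finally show ?thesis .
qed

section \<open>Horizontal fields and the vanishing of the soliton function\<close>

text \<open>On such fields \<open>\<gamma>\<close> agrees with \<open>g\<close>, and bracketing with
  \<open>\<xi>\<close> preserves them; the soliton equation can thus be read for
  \<open>\<gamma>\<close> and differentiated repeatedly along \<open>\<xi>\<close>.\<close>

definition horizontal where "horizontal X \<longleftrightarrow> smooth_on U X \<and> (\<forall>x\<in>U. \<eta> x (X x) = 0)"

lemma horizontal_smooth: "horizontal X \<Longrightarrow> smooth_on U X"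
  by (simp add: horizontal_def)

lemma horizontal_lie_bracket_xi:
  assumes "horizontal X"
  shows "horizontal (lie_bracket \<xi> X)"
proof -
  have "dirderiv \<xi> (\<lambda>y. \<eta> y (X y)) x = dirderiv \<xi> (\<lambda>y. 0) x" if "x \<in> U" for x
    by (rule dirderiv_cong[OF that _ refl]) (use assms in \<open>simp add: horizontal_def\<close>)
  then show ?thesis
    using assms by (simp add: horizontal_def eta_lie_bracket_xi smooth_lie_bracket smooth_xi)
qed

lemma lie_derivative_V_horizontal:
  assumes x: "x \<in> U" and X: "horizontal X" and Y: "horizontal Y"
  shows "lie_derivative_metric V \<gamma> X Y x = 2 * \<Lambda> x * \<gamma> x (X x) (Y x) - 2 * star_ricci G \<phi> X Y x"
proof -
  \<comment> \<open>One horizontal argument is enough for \<open>\<gamma> = g\<close>; this matters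
    because \<open>[V, X]\<close> need not be horizontal.\<close>
  have eq: "\<gamma> y u (Y y) = g y u (Y y)" "\<gamma> y (X y) u = g y (X y) u" if "y \<in> U" for y u
    using X Y that by (simp_all add: horizontal_def \<gamma>_def)
  have "dirderiv V (\<lambda>y. \<gamma> y (X y) (Y y)) x = dirderiv V (\<lambda>y. g y (X y) (Y y)) x"
    by (rule dirderiv_cong[OF x _ refl]) (simp add: eq)
  then have "lie_derivative_metric V \<gamma> X Y x = lie_derivative_metric V g X Y x"
    by (simp add: lie_derivative_metric_def eq x)
  then show ?thesis
    using soliton[OF horizontal_smooth[OF X] horizontal_smooth[OF Y] x] by (simp add: eq x)
qed

text \<open>With \<open>B = L_V \<gamma>\<close> on horizontal fields,
  \<open>L_W \<gamma> = L_\<xi> B - 2 B\<close>. The terms in \<open>\<Lambda>\<close> cancel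
  because \<open>\<xi>(\<Lambda>) = 0\<close> and
  \<open>L_\<xi> \<gamma> = 2 \<gamma>\<close>.\<close>

lemma lie_derivative_W_horizontal:
  assumes x: "x \<in> U" and X: "horizontal X" and Y: "horizontal Y"
  shows "lie_derivative_metric W \<gamma> X Y x = 4 * \<gamma> x (X x) (Y x) + 4 * star_ricci G \<phi> X Y x"
proof -
  note [simp] = horizontal_smooth[OF X] horizontal_smooth[OF Y] smooth_V smooth_Lambda smooths
    smooth_mult smooth_star_ricci
  have "dirderiv \<xi> (lie_derivative_metric V \<gamma> X Y) x =
      dirderiv \<xi> (\<lambda>y. 2 * \<Lambda> y * \<gamma> y (X y) (Y y) - 2 * star_ricci G \<phi> X Y y) x"
    by (rule dirderiv_cong[OF x _ refl]) (simp add: lie_derivative_V_horizontal X Y)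
  also have "\<dots> = 2 * \<Lambda> x * dirderiv \<xi> (\<lambda>y. \<gamma> y (X y) (Y y)) x - 2 * dirderiv \<xi> (star_ricci G \<phi> X Y) x"
    by (simp add: dirderiv_diff[OF x] dirderiv_mult[OF x] dirderiv_xi_Lambda[OF x])
  finally show ?thesis
    using X Y
    by (simp add: lie_derivative_gamma_commutator[OF x] lie_derivative_V_horizontal[OF x]
        horizontal_lie_bracket_xi dirderiv_star_ricci[OF x] dirderiv_xi_gamma[OF x] algebra_simps)
qed

text \<open>The same computation with \<open>W\<close> in place of \<open>V\<close>, starting from
  \<open>lie_derivative_W_horizontal\<close>.\<close>

lemma lie_derivative_xi_W_horizontal:
  assumes x: "x \<in> U" and X: "horizontal X" and Y: "horizontal Y"
  shows "lie_derivative_metric (lie_bracket \<xi> W) \<gamma> X Y x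
    = - 8 * \<gamma> x (X x) (Y x) - 8 * star_ricci G \<phi> X Y x"
proof -
  note [simp] = horizontal_smooth[OF X] horizontal_smooth[OF Y] smooth_V smooths
    smooth_mult smooth_star_ricci
  have "dirderiv \<xi> (lie_derivative_metric W \<gamma> X Y) x =
      dirderiv \<xi> (\<lambda>y. 4 * \<gamma> y (X y) (Y y) + 4 * star_ricci G \<phi> X Y y) x"
    by (rule dirderiv_cong[OF x _ refl]) (simp add: lie_derivative_W_horizontal X Y)
  also have "\<dots> = 4 * dirderiv \<xi> (\<lambda>y. \<gamma> y (X y) (Y y)) x + 4 * dirderiv \<xi> (star_ricci G \<phi> X Y) x"
    by (simp add: dirderiv_add[OF x] dirderiv_mult[OF x])
  finally show ?thesis
    using X Y
    by (simp add: lie_derivative_gamma_commutator[where V = W, OF x] lie_derivative_W_horizontal[OF x]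
        horizontal_lie_bracket_xi dirderiv_star_ricci[OF x] dirderiv_xi_gamma[OF x] algebra_simps)
qed

lemma Lambda_gamma_zero:
  assumes x: "x \<in> U" and X: "horizontal X" and Y: "horizontal Y"
  shows "\<Lambda> x * \<gamma> x (X x) (Y x) = 0"
proof -
  note s = horizontal_smooth[OF X] horizontal_smooth[OF Y]
  have W: "smooth_on U W" by (intro smooth_lie_bracket smooth_xi smooth_V)
  have L: "smooth_on U (\<lambda>y. 2 * \<Lambda> y)" by (intro smooth_mult smooth_on_const smooth_Lambda)
  note b = bilinear_gamma[OF x] smooth_gamma
  have "lie_derivative_metric (lie_bracket \<xi> W) \<gamma> X Y x
      = lie_derivative_metric (\<lambda>y. (2 * \<Lambda> y) *\<^sub>R \<xi> y + (-2) *\<^sub>R W y) \<gamma> X Y x"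
    by (rule lie_derivative_metric_cong[OF x]) (simp_all add: lie_bracket_xi_W)
  also have "\<dots> = lie_derivative_metric (\<lambda>y. (2 * \<Lambda> y) *\<^sub>R \<xi> y) \<gamma> X Y x
      + lie_derivative_metric (\<lambda>y. (-2) *\<^sub>R W y) \<gamma> X Y x"
    by (rule lie_derivative_metric_add[OF x b])
      (assumption | rule smooth_scaleR L smooth_xi smooth_on_const W s)+
  \<comment> \<open>The derivatives of \<open>\<Lambda>\<close> produced by the scaling rule are
    multiplied by \<open>\<gamma>(\<xi>, -) = 0\<close>.\<close>
  also have "\<dots> = 2 * \<Lambda> x * lie_derivative_metric \<xi> \<gamma> X Y x - 2 * lie_derivative_metric W \<gamma> X Y x"
    by (simp only: lie_derivative_metric_scaleR[OF x b smooth_xi L s]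
        lie_derivative_metric_scaleR[OF x b W smooth_on_const s] gamma_xi[OF x] dirderiv_const)
  finally show ?thesis
    by (simp add: lie_derivative_xi_W_horizontal[OF x X Y] lie_derivative_W_horizontal[OF x X Y]
        lie_derivative_gamma[OF x s])
qed

lemma Lambda_zero:
  assumes x: "x \<in> U" and dim: "CARD('m) \<ge> 2"
  shows "\<Lambda> x = 0"
proof -
  \<comment> \<open>The dimension bound provides a direction off the Reeb line, hence a horizontal
    vector on which \<open>\<gamma>\<close> is positive.\<close>
  have "dim (span {\<xi> x}) < DIM(real ^ 'm)"
    using dim dim_le_card[of "{\<xi> x}" "{\<xi> x}"] by (simp add: span_superset)
  then have "span {\<xi> x} \<noteq> UNIV" by (metis dim_UNIV less_irrefl)
  then obtain z where z: "z \<notin> span {\<xi> x}" by blast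
  \<comment> \<open>The horizontal projection of the constant field \<open>z\<close>; it is nonzero
    at \<open>x\<close> because \<open>z\<close> is not a multiple of
    \<open>\<xi> x\<close>.\<close>
  define X where "X = (\<lambda>y. z - \<eta> y z *\<^sub>R \<xi> y)"
  have "horizontal X"
    unfolding horizontal_def X_def
    by (auto intro!: smooth_diff smooth_scaleR smooth_on_const smooth_eta smooth_xi simp: eta_simps)
  then have *: "\<Lambda> x * g x (X x) (X x) = 0"
    using Lambda_gamma_zero[OF x] x by (force simp: \<gamma>_def horizontal_def)
  have "X x \<noteq> 0"
    using z by (metis X_def eq_iff_diff_eq_0 insertI1 span_base span_scale)
  then show ?thesis using * g_pos[OF x, of "X x"] by simp
qed

end

section \<open>From coordinate domains to the manifold\<close>

theorem theorem3p1:
  fixes M :: "'a topology"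
    and A :: "('a, 'm::finite) chart set"
    and \<phi> :: "('a, 'm) endo"
    and \<xi> V :: "('a, 'm) vfield"
    and \<eta> :: "('a, 'm) form1"
    and g :: "('a, 'm) form2"
    and \<Gamma> :: "('a, 'm) conn"
    and lam :: "'a \<Rightarrow> real"
    and n :: nat
  assumes "n > 1"
    and "CARD('m) = 2 * n + 1"
    and "kenmotsu M A \<phi> \<xi> \<eta> g \<Gamma>"
    and "almost_star_ricci_soliton A \<phi> g \<Gamma> V lam"
    and "jacobi_along A \<Gamma> \<xi> V"
  shows "steady_star_ricci_soliton M A \<phi> g \<Gamma> V lam"
proof -
  note defs = kenmotsu_def almost_contact_metric_def smooth_manifold_def endo_field_def
    vector_field_def one_form_def riemannian_metric_def levi_civita_def affine_connection_def
    almost_star_ricci_soliton_def smooth_function_def jacobi_along_def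
  have manifold: "smooth_manifold M A" using assms(3) by (simp add: kenmotsu_def)
  have zero: "lam (chart_inv c x) = 0" if c: "c \<in> A" and x: "x \<in> chart_image c" for c x
  proof -
    \<comment> \<open>Each chart carries the local structure, with the coordinate expression of
      \<open>lam\<close> as soliton function.\<close>
    interpret star_ricci_soliton_domain "chart_image c" "\<Gamma> c" "\<phi> c" "\<xi> c" "\<eta> c" "g c" "V c"
      "lam \<circ> chart_inv c"
    proof
      show "open (chart_image c)" using manifold c by (simp add: smooth_manifold_def)
    qed (use assms(3-5) c in \<open>simp_all add: defs linear_add linear_cmul\<close>)
    show ?thesis using Lambda_zero[OF x] assms(1,2) by simp
  qed
  have "lam p = 0" if "p \<in> topspace M" for p
  proof -
    have "p \<in> (\<Union>c\<in>A. fst c)" using that manifold by (simp add: smooth_manifold_def)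
    then obtain c where c: "c \<in> A" "p \<in> fst c" by blast
    then have "homeomorphic_map (subtopology M (fst c)) (top_of_set (chart_image c)) (snd c)"
      "openin M (fst c)"
      using manifold by (auto simp: smooth_manifold_def)
    \<comment> \<open>Injectivity of the chart makes \<open>chart_inv c\<close> a genuine inverse at
      \<open>p\<close>, so the vanishing in coordinates is the vanishing of
      \<open>lam p\<close>.\<close>
    then have "inj_on (snd c) (fst c)"
      using openin_subset by (fastforce simp: homeomorphic_eq_everything_map inf.absorb2)
    then have "chart_inv c (snd c p) = p"
      using c(2) by (simp add: chart_inv_def)
    then show ?thesis
      using zero[OF c(1), of "snd c p"] c(2) by (simp add: chart_image_def)
  qed
  then show ?thesis using assms(4) by (simp add: steady_star_ricci_soliton_def)
qed

end
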